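(* For each $\ell\in\{1,\dots,N\}$, the expression $$\|w_{h,\ell}\|_{V_{0,\ell}}:=\|\mathrm{imp}^h_{\Gamma_\ell}w_{h,\ell}\|_{L^2(\Gamma_\ell)},\quad w_{h,\ell}\in V_{0,\ell},$$ is a norm on $V_{0,\ell}$, and the expression $$\|\boldsymbol w_h\|_{\mathbb V_0}:=\Big(\sum_{\ell=1}^N\|w_{h,\ell}\|_{V_{0,\ell}}^2\Big)^{1/2},\quad\boldsymbol w_h=(w_{h,1},\dots,w_{h,N})^\top\in\mathbb V_0,$$ is a norm on $\mathbb V_0:=\prod_{\ell=1}^NV_{0,\ell}$.
   Context: Setting. $\Omega\subset\mathbb R^d$ ($d=2,3$) is a bounded Lipschitz (polygonal/polyhedral) domain and $k>0$. $V\subset H^1(\Omega)$ is the nodal finite element space of (complex-valued) continuous piecewise polynomials of total degree $\le p$ on a conforming simplicial mesh $T^h$ of $\Omega$. $\{\Omega_j\}_{j=1}^N$ is an overlapping cover of $\Omega$ by Lipschitz polygonal/polyhedral subdomains whose boundaries are resolved by $T^h$. $V_\ell:=\{v_h|_{\overline{\Omega_\ell}}:v_h\in V\}$, $\Gamma_\ell:=\partial\Omega_\ell\setminus\partial\Omega$, and $V(\Gamma_\ell)$ is the space of restrictions to $\Gamma_\ell$ of functions in $V$. $a_{\Omega_\ell}(v,w):=\int_{\Omega_\ell}(\nabla v\cdot\overline{\nabla w}-k^2v\overline w)-\mathrm{i}k\int_{\partial\Omega_\ell}v\overline w$. $H^1_{0,\Gamma_\ell}(\Omega_\ell):=\{v\in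 H^1(\Omega_\ell):v=0\text{ on }\Gamma_\ell\}$. $$V_{0,\ell}:=\{w_{h,\ell}\in V_\ell: a_{\Omega_\ell}(w_{h,\ell},v_{h,\ell})=0\ \text{ for all }v_{h,\ell}\in V_\ell\cap H^1_{0,\Gamma_\ell}(\Omega_\ell)\}.$$ For $w_{h,\ell}\in V_{0,\ell}$, its discrete impedance data $\mathrm{imp}^h_{\Gamma_\ell}w_{h,\ell}$ is the unique element of $V(\Gamma_\ell)$ with $\int_{\Gamma_\ell}(\mathrm{imp}^h_{\Gamma_\ell}w_{h,\ell})\overline{v_{h,\ell}}=a_{\Omega_\ell}(w_{h,\ell},v_{h,\ell})$ for all $v_{h,\ell}\in V_\ell$. Standing assumption: for each $\ell$ the operator $\mathcal A_{h,\ell}:V_\ell\to V_\ell'$, $(\mathcal A_{h,\ell}v)(w)=a_{\Omega_\ell}(v,w)$, is invertible. *)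

theory Defs
  imports "HOL-Analysis.Analysis" "HOL-Library.Function_Algebras"
begin

section \<open>Norms on complex vector spaces of functions\<close>

definition norm_on :: "(complex \<Rightarrow> 'v \<Rightarrow> 'v) \<Rightarrow> 'v::ab_group_add set \<Rightarrow> ('v \<Rightarrow> real) \<Rightarrow> bool" where
  "norm_on scl S nrm \<longleftrightarrow>
     vector_space scl \<and> module.subspace scl S \<and>
     (\<forall>u\<in>S. 0 \<le> nrm u) \<and>
     (\<forall>u\<in>S. nrm u = 0 \<longleftrightarrow> u = 0) \<and>
     (\<forall>c. \<forall>u\<in>S. nrm (scl c u) = cmod c * nrm u) \<and>
     (\<forall>u\<in>S. \<forall>v\<in>S. nrm (u + v) \<le> nrm u + nrm v)"

definition scale_fun :: "complex \<Rightarrow> ('a \<Rightarrow> complex) \<Rightarrow> 'a \<Rightarrow> complex" where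
  "scale_fun c v = (\<lambda>x. c * v x)"

definition scale_tuple :: "complex \<Rightarrow> (nat \<Rightarrow> 'a \<Rightarrow> complex) \<Rightarrow> nat \<Rightarrow> 'a \<Rightarrow> complex" where
  "scale_tuple c w = (\<lambda>j. scale_fun c (w j))"

text \<open>A function on a set \<open>S\<close> is represented by its extension by zero to the whole space, so that
  equality of representatives is pointwise equality on \<open>S\<close>.\<close>

definition restrict_to :: "'a set \<Rightarrow> ('a \<Rightarrow> complex) \<Rightarrow> 'a \<Rightarrow> complex" where
  "restrict_to S v = (\<lambda>x. if x \<in> S then v x else 0)"


section \<open>Surface measure\<close>

text \<open>The surface measure on boundaries is the \<open>(d - 1)\<close>-dimensional Hausdorff measure, normalised so
  that it agrees with Lebesgue measure on \<open>(d - 1)\<close>-dimensional affine subspaces.\<close>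

definition hausdorff_weight :: "nat \<Rightarrow> 'a::metric_space set \<Rightarrow> ennreal" where
  "hausdorff_weight s U =
     (if U = {} then 0 else ennreal (unit_ball_vol (real s) * (diameter U / 2) ^ s))"

definition hausdorff_pre :: "nat \<Rightarrow> real \<Rightarrow> 'a::metric_space set \<Rightarrow> ennreal" where
  "hausdorff_pre s \<delta> A =
     (INF U \<in> {U :: nat \<Rightarrow> 'a set. A \<subseteq> (\<Union>i. U i) \<and> (\<forall>i. bounded (U i) \<and> diameter (U i) \<le> \<delta>)}.
        \<Sum>i. hausdorff_weight s (U i))"

definition hausdorff_outer :: "nat \<Rightarrow> 'a::metric_space set \<Rightarrow> ennreal" where
  "hausdorff_outer s A = (SUP \<delta> \<in> {0<..}. hausdorff_pre s \<delta> A)"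

definition hausdorff_measure :: "nat \<Rightarrow> 'a::metric_space measure" where
  "hausdorff_measure s = measure_of UNIV (sets borel) (hausdorff_outer s)"

definition surface_measure :: "(real^'n) measure" where
  "surface_measure = hausdorff_measure (CARD('n) - 1)"


section \<open>Domains and meshes\<close>

text \<open>In the condition on the boundary, \<open>y - (y \<bullet> \<nu>) *\<^sub>R \<nu>\<close> is the orthogonal projection of \<open>y\<close> onto the
  hyperplane normal to \<open>\<nu>\<close>; near \<open>x\<close> the set is the strict epigraph in direction \<open>\<nu>\<close> of the
  Lipschitz function \<open>\<phi>\<close> of that projection.\<close>

definition lipschitz_domain :: "'a::euclidean_space set \<Rightarrow> bool" where
  "lipschitz_domain \<Omega> \<longleftrightarrow>
     open \<Omega> \<and> connected \<Omega> \<and> \<Omega> \<noteq> {} \<and>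
     (\<forall>x\<in>frontier \<Omega>. \<exists>\<nu> \<phi> L U. norm \<nu> = 1 \<and> L-lipschitz_on UNIV (\<phi> :: 'a \<Rightarrow> real) \<and>
        open U \<and> x \<in> U \<and>
        (\<forall>y\<in>U. y \<in> \<Omega> \<longleftrightarrow> \<phi> (y - (y \<bullet> \<nu>) *\<^sub>R \<nu>) < y \<bullet> \<nu>))"

definition conforming_simplicial_mesh :: "(real^'n) set set \<Rightarrow> (real^'n) set \<Rightarrow> bool" where
  "conforming_simplicial_mesh T \<Omega> \<longleftrightarrow>
     triangulation T \<and> (\<forall>K\<in>T. int CARD('n) simplex K) \<and> \<Union>T = closure \<Omega>"

definition boundary_resolved_by :: "'a::euclidean_space set set \<Rightarrow> 'a set \<Rightarrow> bool" where
  "boundary_resolved_by T D \<longleftrightarrow>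
     (\<exists>\<F>. \<F> \<subseteq> {F. \<exists>K\<in>T. F facet_of K} \<and> frontier D = \<Union>\<F>)"

definition interface :: "'a::topological_space set \<Rightarrow> 'a set \<Rightarrow> 'a set" where
  "interface \<Omega> D = frontier D - frontier \<Omega>"


section \<open>Finite element spaces\<close>

definition polynomials_total_degree :: "nat \<Rightarrow> (real^'n \<Rightarrow> complex) set" where
  "polynomials_total_degree p =
     {q. \<exists>c :: ('n \<Rightarrow> nat) \<Rightarrow> complex.
        q = (\<lambda>x. \<Sum>\<alpha> | (\<Sum>i\<in>UNIV. \<alpha> i) \<le> p. c \<alpha> * (\<Prod>i\<in>UNIV. of_real (x $ i) ^ \<alpha> i))}"

definition fe_space :: "(real^'n) set \<Rightarrow> (real^'n) set set \<Rightarrow> nat \<Rightarrow> (real^'n \<Rightarrow> complex) set" where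
  "fe_space \<Omega> T p =
     {v. continuous_on (closure \<Omega>) v \<and> (\<forall>x. x \<notin> closure \<Omega> \<longrightarrow> v x = 0) \<and>
         (\<forall>K\<in>T. \<exists>q\<in>polynomials_total_degree p. \<forall>x\<in>K. v x = q x)}"

text \<open>With \<open>S = closure D\<close> this is the local space on \<open>D\<close>, with \<open>S = interface \<Omega> D\<close> the space of
  traces on the interface.\<close>

definition fe_restriction ::
  "(real^'n) set \<Rightarrow> (real^'n) set set \<Rightarrow> nat \<Rightarrow> (real^'n) set \<Rightarrow> (real^'n \<Rightarrow> complex) set" where
  "fe_restriction \<Omega> T p S = restrict_to S ` fe_space \<Omega> T p"


section \<open>Helmholtz sesquilinear form and discrete impedance data\<close>

text \<open>Finite element functions are polynomial on each simplex, so this classical gradient exists off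
  the null set of simplex boundaries and is there the weak gradient. The integrals below are taken
  with respect to the completed Lebesgue measure, for which the values on that null set do not matter.\<close>

definition grad :: "(real^'n \<Rightarrow> complex) \<Rightarrow> real^'n \<Rightarrow> complex^'n" where
  "grad v x = (\<chi> i. frechet_derivative v (at x) (axis i 1))"

definition helmholtz_form ::
  "real \<Rightarrow> (real^'n) set \<Rightarrow> (real^'n \<Rightarrow> complex) \<Rightarrow> (real^'n \<Rightarrow> complex) \<Rightarrow> complex" where
  "helmholtz_form k D v w =
     (LINT x:D|lebesgue. (\<Sum>i\<in>UNIV. grad v x $ i * cnj (grad w x $ i))
                          - (of_real k)\<^sup>2 * v x * cnj (w x))
     - \<i> * of_real k * (LINT x:frontier D|surface_measure. v x * cnj (w x))"

text \<open>The pairing \<open>w \<mapsto> helmholtz_form k D v w\<close> is antilinear, so the dual consists of the antilinear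
  functionals; all of them are continuous, the space being finite-dimensional. Functionals are
  extensional, so that they are determined by their values on the space.\<close>

definition antidual :: "('a \<Rightarrow> complex) set \<Rightarrow> (('a \<Rightarrow> complex) \<Rightarrow> complex) set" where
  "antidual W =
     {f \<in> extensional W. (\<forall>u\<in>W. \<forall>v\<in>W. f (u + v) = f u + f v) \<and>
                         (\<forall>c. \<forall>u\<in>W. f (scale_fun c u) = cnj c * f u)}"

definition helmholtz_operator ::
  "real \<Rightarrow> (real^'n) set \<Rightarrow> (real^'n \<Rightarrow> complex) set \<Rightarrow>
     (real^'n \<Rightarrow> complex) \<Rightarrow> (real^'n \<Rightarrow> complex) \<Rightarrow> complex" where
  "helmholtz_operator k D W v = restrict (\<lambda>w. helmholtz_form k D v w) W"

text \<open>The test functions are the elements of the local space that lie in \<open>H\<^sup>1\<close> with vanishing trace on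
  the interface; elements of the local space are in \<open>H\<^sup>1\<close> and continuous up to the boundary, so this
  means that they vanish there pointwise.\<close>

definition discrete_helmholtz_space ::
  "real \<Rightarrow> (real^'n) set \<Rightarrow> (real^'n) set set \<Rightarrow> nat \<Rightarrow> (real^'n) set \<Rightarrow> (real^'n \<Rightarrow> complex) set" where
  "discrete_helmholtz_space k \<Omega> T p D =
     {w \<in> fe_restriction \<Omega> T p (closure D).
        \<forall>v \<in> fe_restriction \<Omega> T p (closure D).
          (\<forall>x\<in>interface \<Omega> D. v x = 0) \<longrightarrow> helmholtz_form k D w v = 0}"

definition discrete_impedance ::
  "real \<Rightarrow> (real^'n) set \<Rightarrow> (real^'n) set set \<Rightarrow> nat \<Rightarrow> (real^'n) set \<Rightarrow>
     (real^'n \<Rightarrow> complex) \<Rightarrow> real^'n \<Rightarrow> complex" where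
  "discrete_impedance k \<Omega> T p D w =
     (THE g. g \<in> fe_restriction \<Omega> T p (interface \<Omega> D) \<and>
        (\<forall>v \<in> fe_restriction \<Omega> T p (closure D).
           (LINT x:interface \<Omega> D|surface_measure. g x * cnj (v x)) = helmholtz_form k D w v))"

definition local_norm ::
  "real \<Rightarrow> (real^'n) set \<Rightarrow> (real^'n) set set \<Rightarrow> nat \<Rightarrow> (real^'n) set \<Rightarrow> (real^'n \<Rightarrow> complex) \<Rightarrow> real" where
  "local_norm k \<Omega> T p D w =
     sqrt (LINT x:interface \<Omega> D|surface_measure. (cmod (discrete_impedance k \<Omega> T p D w x))\<^sup>2)"

text \<open>Tuples indexed by \<open>{1..N}\<close> are represented by sequences that vanish at all other indices.\<close>

definition product_space ::
  "real \<Rightarrow> (real^'n) set \<Rightarrow> (real^'n) set set \<Rightarrow> nat \<Rightarrow> nat \<Rightarrow> (nat \<Rightarrow> (real^'n) set) \<Rightarrow>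
     (nat \<Rightarrow> real^'n \<Rightarrow> complex) set" where
  "product_space k \<Omega> T p N \<Omega>s =
     {w. (\<forall>l\<in>{1..N}. w l \<in> discrete_helmholtz_space k \<Omega> T p (\<Omega>s l)) \<and>
         (\<forall>l. l \<notin> {1..N} \<longrightarrow> w l = 0)}"

definition product_norm ::
  "real \<Rightarrow> (real^'n) set \<Rightarrow> (real^'n) set set \<Rightarrow> nat \<Rightarrow> nat \<Rightarrow> (nat \<Rightarrow> (real^'n) set) \<Rightarrow>
     (nat \<Rightarrow> real^'n \<Rightarrow> complex) \<Rightarrow> real" where
  "product_norm k \<Omega> T p N \<Omega>s w = sqrt (\<Sum>l=1..N. (local_norm k \<Omega> T p (\<Omega>s l) (w l))\<^sup>2)"

end

theory Submission
  imports Defs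
begin

text \<open>The local expression is an \<open>L\<^sup>2\<close> norm pulled back along the map \<open>w \<mapsto> imp w\<close>, so it is a norm as soon as
  this map is well defined, linear and injective on \<open>V\<^sub>0\<close>.

  It is well defined by the Riesz representation theorem on the finite-dimensional space \<open>V(\<Gamma>)\<close> of
  traces. For \<open>w\<close> in \<open>V\<^sub>0\<close> the functional \<open>v \<mapsto> a(w, v)\<close> vanishes on all \<open>v\<close> that are zero on \<open>\<Gamma>\<close>, so it
  depends only on the trace of \<open>v\<close> and is an antilinear functional on \<open>V(\<Gamma>)\<close>; the \<open>L\<^sup>2(\<Gamma>)\<close> product
  represents it by exactly one trace (\<open>impedance_ex1\<close>). Uniqueness makes \<open>imp\<close> linear, because \<open>a\<close> is
  linear in its first argument. It is injective because \<open>imp w = 0\<close> gives \<open>a(w, v) = 0\<close> for every \<open>v\<close>,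
  and then \<open>w = 0\<close> since the Helmholtz operator is invertible (\<open>form_nondegenerate\<close>). The norm on the
  product is the Euclidean combination of the local norms.

  Let \<open>d\<close> be the dimension of the space. The analytic content lies in the claim that the \<open>L\<^sup>2(\<Gamma>)\<close> product is a definite Hermitian form on traces.
  Since the surface measure is a Hausdorff measure built from coverings, this takes three facts.
  \<^item> The Hausdorff outer measure is additive on separated sets, hence by Caratheodory's criterion
    countably additive on Borel sets (\<open>emeasure_hausdorff_measure\<close>).
  \<^item> The boundary of a subdomain has finite measure, so that continuous functions are integrable there.
    It is a finite union of facets, and a bounded piece of a hyperplane is covered by about
    \<open>\<epsilon>\<close> to the power \<open>1 - d\<close> pieces of diameter of order \<open>\<epsilon>\<close> (\<open>hausdorff_outer_bounded_hyperplane\<close>).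
  \<^item> Every nonempty relatively open piece of the boundary has positive measure, so that a trace with zero
    \<open>L\<^sup>2\<close> norm vanishes. Near a boundary point the domain lies above a Lipschitz graph, so thickening the
    boundary in the vertical direction fills a ball; and the thickening of a set of diameter \<open>\<delta>\<close> has
    volume at most a constant times \<open>\<delta>\<close> to the power \<open>d - 1\<close> (\<open>hausdorff_outer_lipschitz_frontier_pos\<close>).

  Linearity of \<open>a\<close> in the first argument is obtained without integrating gradients. The volume
  part of \<open>a\<close> is Hermitian, so \<open>a(u, v)\<close> and the conjugate of \<open>a(v, u)\<close> differ only by a boundary integral
  (\<open>helmholtz_form_cnj\<close>); antilinearity in the second argument is part of the assumption that the
  operator takes its values in the antidual space.\<close>

section \<open>Hausdorff outer measure is a Borel measure\<close>

lemma outer_measure_space_mono: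
  "outer_measure_space (Pow UNIV) f \<Longrightarrow> A \<subseteq> B \<Longrightarrow> f A \<le> f B"
  unfolding outer_measure_space_def increasing_def by auto

text \<open>Countable subadditivity in \<open>outer_measure_space\<close> concerns disjoint families only; monotonicity extends it
  to all sequences.\<close>

lemma outer_measure_space_UN_le:
  fixes A :: "nat \<Rightarrow> 'a set"
  assumes "outer_measure_space (Pow UNIV) f"
  shows "f (\<Union>i. A i) \<le> (\<Sum>i. f (A i))"
proof -
  have "f (\<Union>i. disjointed A i) \<le> (\<Sum>i. f (disjointed A i))"
    using assms disjoint_family_disjointed[of A]
    unfolding outer_measure_space_def countably_subadditive_def by blast
  also have "\<dots> \<le> (\<Sum>i. f (A i))"
    by (intro suminf_le allI outer_measure_space_mono[OF assms] disjointed_subset) auto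
  finally show ?thesis by (simp add: UN_disjointed_eq)
qed

lemma outer_measure_space_Un_le:
  assumes "outer_measure_space (Pow UNIV) f"
  shows "f (A \<union> B) \<le> f A + f B"
proof -
  have "f {} = 0" using assms unfolding outer_measure_space_def positive_def by auto
  then show ?thesis
    using outer_measure_space_UN_le[OF assms, of "binaryset A B"]
    by (simp add: UN_binaryset_eq suminf_binaryset_eq)
qed

text \<open>For a closed set \<open>C\<close> the part \<open>A - C\<close> of a test set is exhausted by the points of \<open>A\<close> at distance at least
  \<open>1 / (n + 1)\<close> from \<open>C\<close>, and these are separated from \<open>A \<inter> C\<close>. What is left over lies in the shells \<open>R m\<close> of
  points whose distance is between \<open>1 / (m + 2)\<close> and \<open>1 / (m + 1)\<close>, for \<open>m \<ge> n\<close>. Shells whose indices differ by two are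
  separated, so the even ones together, and likewise the odd ones, have measure at most \<open>f A\<close>. The measures of
  the shells are therefore summable and the left-over tends to zero.\<close>

lemma caratheodory_criterion:
  fixes f :: "'a::metric_space set \<Rightarrow> ennreal"
  assumes oms: "outer_measure_space (Pow UNIV) f"
    and separated: "\<And>A B r. 0 < r \<Longrightarrow> (\<And>a b. a \<in> A \<Longrightarrow> b \<in> B \<Longrightarrow> r \<le> dist a b) \<Longrightarrow> f A + f B \<le> f (A \<union> B)"
    and "closed C"
  shows "C \<in> lambda_system UNIV (Pow UNIV) f"
proof -
  have f_empty: "f {} = 0"
    using oms unfolding outer_measure_space_def positive_def by auto
  note f_mono = outer_measure_space_mono[OF oms]
  note f_UN = outer_measure_space_UN_le[OF oms]
  note f_Un = outer_measure_space_Un_le[OF oms]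
  have main: "f (A \<inter> C) + f (A - C) \<le> f A" if fin: "f A < top" and ne: "C \<noteq> {}" for A
  proof -
    define c where "c n = inverse (real (Suc n))" for n
    define R where "R n = {x \<in> A. c (Suc n) \<le> infdist x C \<and> infdist x C < c n}" for n
    have c_less: "c n < c m" if "m < n" for m n
      using that unfolding c_def by (simp add: field_simps)
    have c_le: "c n \<le> c m" if "m \<le> n" for m n
      using that unfolding c_def by (simp add: field_simps)
    have R_sub: "R n \<subseteq> A" for n by (auto simp: R_def)
    \<comment> \<open>With e = 0 or e = 1 this treats the even or the odd shells; the earlier shells lie at distance at least
      c (2 m + e + 1) from C, where n = m + 1, and the next one closer than c (2 n + e).\<close>
    have step: "f (\<Union>i<n. R (2 * i + e)) + f (R (2 * n + e)) \<le> f ((\<Union>i<n. R (2 * i + e)) \<union> R (2 * n + e))" for n e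
    proof (cases n)
      case 0 then show ?thesis by (simp add: f_empty)
    next
      case (Suc m)
      show ?thesis
      proof (rule separated[where r = "c (2 * m + e + 1) - c (2 * n + e)"])
        show "0 < c (2 * m + e + 1) - c (2 * n + e)" using c_less[of "2*m+e+1" "2*n+e"] Suc by simp
        fix a b assume "a \<in> (\<Union>i<n. R (2 * i + e))" and b: "b \<in> R (2 * n + e)"
        then obtain i where i: "i < n" "a \<in> R (2 * i + e)" by auto
        have "c (2 * m + e + 1) \<le> c (Suc (2 * i + e))" using i Suc by (intro c_le) auto
        moreover have "infdist a C \<le> infdist b C + dist a b" by (rule infdist_triangle)
        ultimately show "c (2 * m + e + 1) - c (2 * n + e) \<le> dist a b"
          using i b unfolding R_def by auto
      qed
    qed
    have alternate: "(\<Sum>i<n. f (R (2 * i + e))) \<le> f (\<Union>i<n. R (2 * i + e))" for n e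
    proof (induction n)
      case (Suc n)
      have "(\<Sum>i<Suc n. f (R (2 * i + e))) \<le> f (\<Union>i<n. R (2 * i + e)) + f (R (2 * n + e))"
        using Suc by (simp add: add_right_mono)
      also have "\<dots> \<le> f ((\<Union>i<n. R (2 * i + e)) \<union> R (2 * n + e))" by (rule step)
      finally show ?case by (simp add: lessThan_Suc Un_commute)
    qed simp
    have alternate_le: "(\<Sum>i<n. f (R (2 * i + e))) \<le> f A" for n e
      using alternate[of e n] f_mono[of "\<Union>i<n. R (2 * i + e)" A] R_sub by fastforce
    have split: "(\<Sum>k<2 * n. f (R k)) = (\<Sum>i<n. f (R (2 * i + 0))) + (\<Sum>i<n. f (R (2 * i + 1)))" for n
      by (induction n) (auto simp: algebra_simps)
    have partial: "(\<Sum>k<n. f (R k)) \<le> f A + f A" for n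
    proof -
      have "(\<Sum>k<n. f (R k)) \<le> (\<Sum>k<2 * n. f (R k))" by (intro sum_mono2) auto
      also have "\<dots> \<le> f A + f A" unfolding split by (intro add_mono alternate_le)
      finally show ?thesis .
    qed
    define total where "total = (\<Sum>k. f (R k))"
    have total: "total < top"
      unfolding total_def using suminf_le_const[OF summableI partial] fin
      by (meson ennreal_add_less_top le_less_trans)
    have tail: "\<exists>n. (\<Sum>k. f (R (k + n))) \<le> ennreal e" if "0 < e" for e
    proof (rule ccontr)
      assume "\<nexists>n. (\<Sum>k. f (R (k + n))) \<le> ennreal e"
      then have big: "ennreal e \<le> (\<Sum>k. f (R (k + n)))" for n by (meson linear)
      have "(\<Sum>k<n. f (R k)) + ennreal e \<le> total" for n
      proof -
        have "(\<Sum>k<n. f (R k)) + ennreal e \<le> (\<Sum>k<n. f (R k)) + (\<Sum>k. f (R (k + n)))"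
          by (intro add_left_mono big)
        also have "\<dots> = total"
          unfolding total_def using suminf_offset[OF summableI, of "\<lambda>k. f (R k)" n] by (simp add: add.commute)
        finally show ?thesis .
      qed
      then have "(SUP n. (\<Sum>k<n. f (R k)) + ennreal e) \<le> total" by (intro SUP_least)
      then have "total + ennreal e \<le> total"
        by (simp add: ennreal_SUP_add_left suminf_eq_SUP[symmetric] total_def)
      then show False
        using total that ennreal_add_left_cancel_le[of total "ennreal e" 0] by (auto simp: less_top)
    qed
    show ?thesis
    proof (rule ennreal_le_epsilon)
      fix e :: real assume "0 < e"
      then obtain n where n: "(\<Sum>k. f (R (k + n))) \<le> ennreal e" using tail by blast
      define A' where "A' = {x \<in> A. c n \<le> infdist x C}"
      have "A - C \<subseteq> A' \<union> (\<Union>k. R (k + n))"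
      proof
        fix x assume x: "x \<in> A - C"
        then have "infdist x C > 0"
          using in_closed_iff_infdist_zero[OF \<open>closed C\<close> ne, of x] infdist_nonneg[of x C] by simp
        then obtain m0 where "c m0 < infdist x C"
          unfolding c_def using reals_Archimedean by blast
        then have ex: "\<exists>m. c m \<le> infdist x C" by (auto intro: less_imp_le)
        \<comment> \<open>The least m with c m at most the distance of x places x in a shell, or in A' when m is at most n.\<close>
        define m where "m = (LEAST m. c m \<le> infdist x C)"
        have m: "c m \<le> infdist x C" unfolding m_def using ex by (rule LeastI_ex)
        show "x \<in> A' \<union> (\<Union>k. R (k + n))"
        proof (cases "m \<le> n")
          case True
          then have "c n \<le> infdist x C" using m c_le[of m n] by simp
          then show ?thesis using x by (simp add: A'_def)
        next
          case False
          then obtain j where j: "m = Suc (j + n)" by (metis add.commute add_Suc_right less_iff_Suc_add not_le)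
          have "infdist x C < c (j + n)"
            using not_less_Least[of "j + n" "\<lambda>m. c m \<le> infdist x C"] j unfolding m_def by simp
          then have "x \<in> R (j + n)" using m j x by (simp add: R_def)
          then show ?thesis by blast
        qed
      qed
      then have "f (A - C) \<le> f (A' \<union> (\<Union>k. R (k + n)))" by (rule f_mono)
      also have "\<dots> \<le> f A' + f (\<Union>k. R (k + n))" by (rule f_Un)
      also have "\<dots> \<le> f A' + ennreal e"
        using f_UN[of "\<lambda>k. R (k + n)"] n by (intro add_left_mono) auto
      finally have "f (A \<inter> C) + f (A - C) \<le> (f (A \<inter> C) + f A') + ennreal e"
        by (simp add: add.assoc add_left_mono)
      also have "f (A \<inter> C) + f A' \<le> f ((A \<inter> C) \<union> A')"
      proof (rule separated[where r = "c n"])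
        show "0 < c n" by (simp add: c_def)
        fix a b assume "a \<in> A \<inter> C" "b \<in> A'"
        then show "c n \<le> dist a b"
          using infdist_le[of a C b] by (auto simp: A'_def dist_commute)
      qed
      also have "f ((A \<inter> C) \<union> A') \<le> f A" by (intro f_mono) (auto simp: A'_def)
      finally show "f (A \<inter> C) + f (A - C) \<le> f A + ennreal e" by (simp add: add_right_mono)
    qed
  qed
  have "f (A \<inter> C) + f (A - C) = f A" for A
  proof (rule antisym)
    show "f (A \<inter> C) + f (A - C) \<le> f A"
    proof (cases "f A < top \<and> C \<noteq> {}")
      case True then show ?thesis using main by blast
    next
      case False then show ?thesis using f_empty by (cases "f A = top") (auto simp: less_top)
    qed
    show "f A \<le> f (A \<inter> C) + f (A - C)"
      using f_Un[of "A \<inter> C" "A - C"] by (simp add: Int_Diff_Un)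
  qed
  then show ?thesis
    by (simp add: lambda_system_def Diff_eq Int_commute)
qed

lemma hausdorff_weight_empty [simp]: "hausdorff_weight s {} = 0"
  by (simp add: hausdorff_weight_def)

lemma hausdorff_pre_le:
  assumes "A \<subseteq> (\<Union>i. U i)" "\<And>i. bounded (U i)" "\<And>i. diameter (U i) \<le> \<delta>"
  shows "hausdorff_pre s \<delta> A \<le> (\<Sum>i. hausdorff_weight s (U i))"
  unfolding hausdorff_pre_def using assms by (intro INF_lower) auto

lemma hausdorff_pre_lessE:
  assumes "hausdorff_pre s \<delta> A < e"
  obtains U where "A \<subseteq> (\<Union>i::nat. U i)" "\<And>i. bounded (U i)" "\<And>i. diameter (U i) \<le> \<delta>"
    "(\<Sum>i. hausdorff_weight s (U i)) < e"
  using assms unfolding hausdorff_pre_def INF_less_iff by blast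

lemma hausdorff_pre_greatest:
  assumes "\<And>U. A \<subseteq> (\<Union>i::nat. U i) \<Longrightarrow> (\<And>i. bounded (U i)) \<Longrightarrow> (\<And>i. diameter (U i) \<le> \<delta>) \<Longrightarrow>
    e \<le> (\<Sum>i. hausdorff_weight s (U i))"
  shows "e \<le> hausdorff_pre s \<delta> A"
  unfolding hausdorff_pre_def using assms by (intro INF_greatest) auto

lemma hausdorff_pre_mono: "A \<subseteq> B \<Longrightarrow> hausdorff_pre s \<delta> A \<le> hausdorff_pre s \<delta> B"
  by (rule hausdorff_pre_greatest) (auto intro!: hausdorff_pre_le)

lemma hausdorff_pre_antimono: "\<delta> \<le> \<delta>' \<Longrightarrow> hausdorff_pre s \<delta>' A \<le> hausdorff_pre s \<delta> A"
  by (rule hausdorff_pre_greatest) (rule hausdorff_pre_le, auto intro: order.trans[where b = \<delta>])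

lemma hausdorff_pre_finite_cover:
  assumes "finite I" "A \<subseteq> (\<Union>i\<in>I. Q i)" "\<And>i. i \<in> I \<Longrightarrow> bounded (Q i)"
    "\<And>i. i \<in> I \<Longrightarrow> diameter (Q i) \<le> \<delta>" "0 \<le> \<delta>"
  shows "hausdorff_pre s \<delta> A \<le> (\<Sum>i\<in>I. hausdorff_weight s (Q i))"
proof -
  obtain h where h: "bij_betw h {0..<card I} I" using ex_bij_betw_nat_finite[OF \<open>finite I\<close>] by blast
  then have img: "h ` {0..<card I} = I" by (simp add: bij_betw_def)
  define U where "U n = (if n < card I then Q (h n) else {})" for n
  have hI: "h n \<in> I" if "n < card I" for n using that img by auto
  have "A \<subseteq> (\<Union>n. U n)"
  proof
    fix x assume "x \<in> A"
    then obtain i where i: "i \<in> I" "x \<in> Q i" using assms by auto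
    then obtain n where "n < card I" "i = h n"
      using img by force
    then show "x \<in> (\<Union>n. U n)" using i by (auto simp: U_def)
  qed
  then have "hausdorff_pre s \<delta> A \<le> (\<Sum>n. hausdorff_weight s (U n))"
    using assms hI by (intro hausdorff_pre_le) (auto simp: U_def)
  also have "\<dots> = (\<Sum>n\<in>{0..<card I}. hausdorff_weight s (U n))"
    by (intro suminf_finite) (auto simp: U_def)
  also have "\<dots> = (\<Sum>n\<in>{0..<card I}. hausdorff_weight s (Q (h n)))"
    by (intro sum.cong) (auto simp: U_def)
  also have "\<dots> = (\<Sum>i\<in>I. hausdorff_weight s (Q i))"
    by (rule sum.reindex_bij_betw[OF h])
  finally show ?thesis .
qed

lemma hausdorff_pre_empty: "0 \<le> \<delta> \<Longrightarrow> hausdorff_pre s \<delta> {} = 0"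
  using hausdorff_pre_finite_cover[of "{}" "{}" "\<lambda>_. {}" \<delta> s] by simp

text \<open>Concatenate coverings of the \<open>A n\<close> that are optimal up to \<open>e * (1/2) ^ (n + 1)\<close>.\<close>

lemma hausdorff_pre_UN:
  fixes A :: "nat \<Rightarrow> 'a::metric_space set"
  shows "hausdorff_pre s \<delta> (\<Union>n. A n) \<le> (\<Sum>n. hausdorff_pre s \<delta> (A n))"
proof (rule ennreal_le_epsilon)
  fix e :: real assume "0 < e" "(\<Sum>n. hausdorff_pre s \<delta> (A n)) < top"
  then have *: "\<And>n. hausdorff_pre s \<delta> (A n) < hausdorff_pre s \<delta> (A n) + e * (1/2)^Suc n"
    by (auto simp add: less_top dest!: ennreal_suminf_lessD)
  have "\<exists>B. A n \<subseteq> (\<Union>i::nat. B i) \<and> (\<forall>i. bounded (B i)) \<and> (\<forall>i. diameter (B i) \<le> \<delta>) \<and>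
      (\<Sum>i. hausdorff_weight s (B i)) \<le> hausdorff_pre s \<delta> (A n) + e * (1/2)^(Suc n)" for n
    by (rule hausdorff_pre_lessE[OF *[of n]]) (blast intro: less_imp_le)
  then obtain B where B: "\<And>n. A n \<subseteq> (\<Union>i::nat. B n i)" "\<And>n i. bounded (B n i)"
      "\<And>n i. diameter (B n i) \<le> \<delta>"
    and Ble: "\<And>n. (\<Sum>i. hausdorff_weight s (B n i)) \<le> hausdorff_pre s \<delta> (A n) + e * (1/2)^(Suc n)"
    by metis
  define C where "C = case_prod B o prod_decode"
  have "(\<Union>i. A i) \<subseteq> (\<Union>i. C i)"
    using B(1) by (auto simp add: C_def subset_eq) (metis prod.case prod_encode_inverse)
  then have "hausdorff_pre s \<delta> (\<Union>i. A i) \<le> (\<Sum>i. hausdorff_weight s (C i))"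
    using B by (intro hausdorff_pre_le) (auto simp: C_def split: prod.split)
  also have "\<dots> = (\<Sum>n. \<Sum>i. hausdorff_weight s (B n i))"
    unfolding C_def comp_def by (intro suminf_ennreal_2dimen) auto
  also have "\<dots> \<le> (\<Sum>n. hausdorff_pre s \<delta> (A n) + e * (1/2) ^ Suc n)"
    by (intro suminf_le allI Ble) auto
  also have "... = (\<Sum>n. hausdorff_pre s \<delta> (A n)) + (\<Sum>n. ennreal e * ennreal ((1/2) ^ Suc n))"
    using \<open>0 < e\<close> by (subst suminf_add[symmetric])
                     (auto simp del: ennreal_suminf_cmult simp add: ennreal_mult[symmetric])
  also have "\<dots> = (\<Sum>n. hausdorff_pre s \<delta> (A n)) + e"
    unfolding ennreal_suminf_cmult
    by (subst suminf_ennreal_eq[OF zero_le_power power_half_series]) auto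
  finally show "hausdorff_pre s \<delta> (\<Union>i. A i) \<le> (\<Sum>n. hausdorff_pre s \<delta> (A n)) + e" .
qed

lemma hausdorff_pre_le_outer: "0 < \<delta> \<Longrightarrow> hausdorff_pre s \<delta> A \<le> hausdorff_outer s A"
  unfolding hausdorff_outer_def by (intro SUP_upper) auto

lemma outer_measure_space_hausdorff_outer:
  "outer_measure_space (Pow UNIV) (hausdorff_outer s :: 'a::metric_space set \<Rightarrow> ennreal)"
  unfolding outer_measure_space_def positive_def increasing_def countably_subadditive_def
proof (intro conjI allI ballI impI)
  show "hausdorff_outer s ({} :: 'a set) = 0"
    by (simp add: hausdorff_outer_def hausdorff_pre_empty)
next
  fix A B :: "'a set" assume "A \<subseteq> B"
  then show "hausdorff_outer s A \<le> hausdorff_outer s B"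
    unfolding hausdorff_outer_def by (intro SUP_mono) (auto intro: hausdorff_pre_mono)
next
  fix A :: "nat \<Rightarrow> 'a set"
  show "hausdorff_outer s (\<Union>n. A n) \<le> (\<Sum>n. hausdorff_outer s (A n))"
    unfolding hausdorff_outer_def[of s "\<Union>n. A n"]
  proof (rule SUP_least)
    fix \<delta> :: real assume "\<delta> \<in> {0<..}"
    then have "(\<Sum>n. hausdorff_pre s \<delta> (A n)) \<le> (\<Sum>n. hausdorff_outer s (A n))"
      by (intro suminf_le allI hausdorff_pre_le_outer) auto
    then show "hausdorff_pre s \<delta> (\<Union>n. A n) \<le> (\<Sum>n. hausdorff_outer s (A n))"
      using hausdorff_pre_UN order_trans by blast
  qed
qed

text \<open>A covering set of diameter below \<open>r\<close> cannot meet both \<open>A\<close> and \<open>B\<close>, so every covering of \<open>A \<union> B\<close> splits into one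
  of \<open>A\<close> and one of \<open>B\<close>.\<close>

lemma hausdorff_pre_separated:
  assumes "\<delta> < r" and sep: "\<And>a b. a \<in> A \<Longrightarrow> b \<in> B \<Longrightarrow> r \<le> dist a b" and "0 < \<delta>"
  shows "hausdorff_pre s \<delta> A + hausdorff_pre s \<delta> B \<le> hausdorff_pre s \<delta> (A \<union> B)"
proof (rule hausdorff_pre_greatest)
  fix U :: "nat \<Rightarrow> 'a set"
  assume U: "A \<union> B \<subseteq> (\<Union>i. U i)" "\<And>i. bounded (U i)" "\<And>i. diameter (U i) \<le> \<delta>"
  define V where "V S i = (if U i \<inter> S \<noteq> {} then U i else {})" for S i
  have V: "hausdorff_pre s \<delta> S \<le> (\<Sum>i. hausdorff_weight s (V S i))" if S: "S \<subseteq> A \<union> B" for S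
  proof (rule hausdorff_pre_le)
    show "S \<subseteq> (\<Union>i. V S i)"
    proof
      fix x assume "x \<in> S"
      moreover obtain i where "x \<in> U i" using U(1) S \<open>x \<in> S\<close> by blast
      ultimately have "x \<in> V S i" by (auto simp: V_def)
      then show "x \<in> (\<Union>i. V S i)" by blast
    qed
    show "bounded (V S i)" "diameter (V S i) \<le> \<delta>" for i
      using U \<open>0 < \<delta>\<close> by (auto simp: V_def)
  qed
  have only_one: "U i \<inter> A = {} \<or> U i \<inter> B = {}" for i
  proof (rule ccontr)
    assume "\<not> ?thesis"
    then obtain a b where "a \<in> U i" "a \<in> A" "b \<in> U i" "b \<in> B" by auto
    then have "r \<le> diameter (U i)"
      using sep diameter_bounded_bound[OF U(2)] order_trans by blast
    then show False using U(3)[of i] \<open>\<delta> < r\<close> by simp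
  qed
  have "hausdorff_pre s \<delta> A + hausdorff_pre s \<delta> B
      \<le> (\<Sum>i. hausdorff_weight s (V A i)) + (\<Sum>i. hausdorff_weight s (V B i))"
    by (intro add_mono V) auto
  also have "\<dots> = (\<Sum>i. hausdorff_weight s (V A i) + hausdorff_weight s (V B i))"
    by (rule suminf_add[OF summableI summableI])
  also have "\<dots> \<le> (\<Sum>i. hausdorff_weight s (U i))"
    using only_one by (intro suminf_le allI) (auto simp: V_def)
  finally show "hausdorff_pre s \<delta> A + hausdorff_pre s \<delta> B \<le> (\<Sum>i. hausdorff_weight s (U i))" .
qed

lemma hausdorff_outer_separated:
  assumes "0 < r" and sep: "\<And>a b. a \<in> A \<Longrightarrow> b \<in> B \<Longrightarrow> r \<le> dist a b"
  shows "hausdorff_outer s A + hausdorff_outer s B \<le> hausdorff_outer s (A \<union> B)"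
proof -
  have "hausdorff_pre s \<delta> A + hausdorff_pre s \<delta>' B \<le> hausdorff_outer s (A \<union> B)"
    if "0 < \<delta>" "0 < \<delta>'" for \<delta> \<delta>'
  proof -
    define \<eta> where "\<eta> = min (min \<delta> \<delta>') (r / 2)"
    have \<eta>: "0 < \<eta>" "\<eta> < r" "\<eta> \<le> \<delta>" "\<eta> \<le> \<delta>'" using that \<open>0 < r\<close> by (auto simp: \<eta>_def)
    have "hausdorff_pre s \<delta> A + hausdorff_pre s \<delta>' B \<le> hausdorff_pre s \<eta> A + hausdorff_pre s \<eta> B"
      using \<eta> by (intro add_mono hausdorff_pre_antimono)
    also have "\<dots> \<le> hausdorff_pre s \<eta> (A \<union> B)"
      using \<eta> sep by (intro hausdorff_pre_separated[where r=r]) auto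
    also have "\<dots> \<le> hausdorff_outer s (A \<union> B)" using \<eta> by (intro hausdorff_pre_le_outer)
    finally show ?thesis .
  qed
  then have "(SUP \<delta>\<in>{0<..}. SUP \<delta>'\<in>{0<..}. hausdorff_pre s \<delta> A + hausdorff_pre s \<delta>' B) \<le> hausdorff_outer s (A \<union> B)"
    by (intro SUP_least) auto
  also have "(SUP \<delta>\<in>{0<..}. SUP \<delta>'\<in>{0<..}. hausdorff_pre s \<delta> A + hausdorff_pre s \<delta>' B)
     = hausdorff_outer s A + hausdorff_outer s B"
  proof -
    have ne: "{0<..} \<noteq> ({} :: real set)" by (rule ex_in_conv[THEN iffD1, OF exI[of _ 1]]) simp
    show ?thesis
      unfolding hausdorff_outer_def
      by (simp add: ennreal_SUP_add_left[OF ne] ennreal_SUP_add_right[OF ne, symmetric])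
  qed
  finally show ?thesis .
qed

lemma sets_hausdorff_measure [measurable_cong, simp]: "sets (hausdorff_measure s) = sets borel"
  unfolding hausdorff_measure_def by (metis sets.sets_measure_of_eq space_borel)

lemma space_hausdorff_measure [simp]: "space (hausdorff_measure s) = UNIV"
  by (simp add: hausdorff_measure_def space_measure_of_conv)

text \<open>The value of \<open>measure_of\<close> is the zero measure unless the given set function is countably additive on
  the \<open>\<sigma>\<close>-algebra; it is here because closed sets are Caratheodory measurable and generate the Borel sets.\<close>

lemma emeasure_hausdorff_measure:
  fixes A :: "'a::metric_space set"
  assumes "A \<in> sets borel"
  shows "emeasure (hausdorff_measure s) A = hausdorff_outer s A"
proof -
  let ?L = "lambda_system UNIV (Pow UNIV) (hausdorff_outer s :: 'a set \<Rightarrow> ennreal)"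
  have ms: "measure_space UNIV ?L (hausdorff_outer s)"
    by (rule sigma_algebra.caratheodory_lemma[OF sigma_algebra_Pow outer_measure_space_hausdorff_outer])
  have "Collect closed \<subseteq> ?L"
  proof
    fix C :: "'a set" assume "C \<in> Collect closed"
    then show "C \<in> ?L"
      using caratheodory_criterion[OF outer_measure_space_hausdorff_outer[of s]]
        hausdorff_outer_separated by blast
  qed
  then have "sigma_sets UNIV (Collect closed) \<subseteq> ?L"
    by (intro sigma_algebra.sigma_sets_subset) (use ms in \<open>auto simp: measure_space_def\<close>)
  then have "sets borel \<subseteq> ?L"
    by (subst borel_eq_closed) simp
  then have ms': "measure_space UNIV (sets borel) (hausdorff_outer s :: 'a set \<Rightarrow> ennreal)"
    using measure_down[OF ms] sets.sigma_algebra_axioms[of "borel :: 'a measure"] by simp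
  show ?thesis
    unfolding hausdorff_measure_def
    by (rule emeasure_measure_of_sigma) (use ms' assms in \<open>auto simp: measure_space_def\<close>)
qed

section \<open>Two-sided bounds for the Hausdorff measure of hypersurfaces\<close>

text \<open>Pick a coordinate \<open>i\<close> in which the normal \<open>a\<close> is nonzero. On the hyperplane the other coordinates,
  \<open>s = CARD('n) - 1\<close> in number, determine a point in a Lipschitz way, with constant \<open>C\<close>. Cutting the range of these coordinates into intervals of
  length \<open>h = 2 R / N\<close> therefore covers \<open>S\<close> by \<open>(N + 1) ^ s\<close> sets of diameter at most \<open>C h\<close>, whose total weight
  stays bounded as \<open>N\<close> grows.\<close>

lemma hausdorff_outer_bounded_hyperplane:
  fixes S :: "(real^'n) set"
  assumes "bounded S" and hyp: "\<And>x. x \<in> S \<Longrightarrow> a \<bullet> x = b" and "a \<noteq> 0"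
  shows "hausdorff_outer (CARD('n) - 1) S < top"
proof -
  obtain i where i: "a $ i \<noteq> 0" using \<open>a \<noteq> 0\<close> by (auto simp: vec_eq_iff)
  obtain R where R: "R > 0" "\<And>x. x \<in> S \<Longrightarrow> norm x \<le> R" using \<open>bounded S\<close> bounded_pos by blast
  have comp: "\<bar>x $ j\<bar> \<le> R" if "x \<in> S" for x j
    using R(2)[OF that] component_le_norm_cart[of x j] by simp
  define J where "J = UNIV - {i}"
  define s where "s = CARD('n) - 1"
  have card_J: "card J = s" by (simp add: J_def s_def card_Diff_singleton)
  define C where "C = 1 + real s + (\<Sum>j\<in>J. \<bar>a $ j\<bar>) / \<bar>a $ i\<bar>"
  have C: "C > 0" unfolding C_def by (intro add_pos_nonneg divide_nonneg_nonneg sum_nonneg) auto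
  have close: "norm (x - y) \<le> C * h"
    if "x \<in> S" "y \<in> S" "0 \<le> h" and h: "\<And>j. j \<in> J \<Longrightarrow> \<bar>x $ j - y $ j\<bar> \<le> h" for x y h
  proof -
    have "a \<bullet> (x - y) = 0" using hyp that by (simp add: inner_diff_right)
    then have "a $ i * (x $ i - y $ i) + (\<Sum>j\<in>J. a $ j * (x $ j - y $ j)) = 0"
      by (simp add: inner_vec_def J_def sum.remove[of UNIV i])
    then have "\<bar>a $ i\<bar> * \<bar>x $ i - y $ i\<bar> = \<bar>\<Sum>j\<in>J. a $ j * (x $ j - y $ j)\<bar>"
      by (simp add: abs_mult[symmetric] add_eq_0_iff2)
    also have "\<dots> \<le> (\<Sum>j\<in>J. \<bar>a $ j\<bar> * h)"
      by (rule order_trans[OF sum_abs]) (auto simp: abs_mult intro!: sum_mono mult_left_mono h)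
    finally have xi: "\<bar>x $ i - y $ i\<bar> \<le> (\<Sum>j\<in>J. \<bar>a $ j\<bar>) / \<bar>a $ i\<bar> * h"
      using i by (simp add: sum_distrib_left pos_le_divide_eq mult.commute)
    have "norm (x - y) \<le> (\<Sum>j\<in>UNIV. \<bar>(x - y) $ j\<bar>)" by (rule norm_le_l1_cart)
    also have "\<dots> = \<bar>x $ i - y $ i\<bar> + (\<Sum>j\<in>J. \<bar>x $ j - y $ j\<bar>)"
      by (simp add: J_def sum.remove[of UNIV i])
    also have "(\<Sum>j\<in>J. \<bar>x $ j - y $ j\<bar>) \<le> real s * h"
      using sum_bounded_above[of J "\<lambda>j. \<bar>x $ j - y $ j\<bar>" h] h by (simp add: card_J)
    finally show ?thesis using xi \<open>0 \<le> h\<close> by (simp add: C_def algebra_simps)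
  qed
  define K where "K = unit_ball_vol (real s) * (2 * C * R) ^ s"
  have "hausdorff_pre s \<delta> S \<le> ennreal K" if "\<delta> > 0" for \<delta>
  proof -
    obtain N where N: "real N > 2 * R * C / \<delta>" using reals_Archimedean2 by blast
    moreover have "2 * R * C / \<delta> > 0" using R(1) C that by simp
    ultimately have N_pos: "N > 0" using not_gr_zero by fastforce
    define h where "h = 2 * R / real N"
    have h: "h > 0" "C * h \<le> \<delta>"
      using N N_pos R(1) that by (auto simp: h_def field_simps)
    \<comment> \<open>The coordinates plus R range over [0, 2 R], so the cells are numbered 0 to N; the last one is needed for the
      right end point.\<close>
    define I where "I = (\<Pi>\<^sub>E j\<in>J. {0..N})"
    define Q where "Q f = {x \<in> S. \<forall>j\<in>J. nat \<lfloor>(x $ j + R) / h\<rfloor> = f j}" for f :: "'n \<Rightarrow> nat"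
    have fin_I: "finite I" unfolding I_def J_def by (intro finite_PiE) auto
    have card_I: "card I = (N + 1) ^ s"
      unfolding I_def J_def by (subst card_PiE) (auto simp: card_J[unfolded J_def])
    have Q_close: "norm (x - y) \<le> C * h" if "x \<in> Q f" "y \<in> Q f" for x y f
    proof (rule close)
      show "x \<in> S" "y \<in> S" "0 \<le> h" using that h by (auto simp: Q_def)
      fix j assume j: "j \<in> J"
      define u v where "u = (x $ j + R) / h" and "v = (y $ j + R) / h"
      have "0 \<le> x $ j + R" "0 \<le> y $ j + R"
        using comp[OF \<open>x \<in> S\<close>, of j] comp[OF \<open>y \<in> S\<close>, of j] by linarith+
      then have "0 \<le> u" "0 \<le> v" using h by (auto simp: u_def v_def)
      moreover have "nat \<lfloor>u\<rfloor> = nat \<lfloor>v\<rfloor>" using that j by (simp add: Q_def u_def v_def)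
      ultimately have "\<lfloor>u\<rfloor> = \<lfloor>v\<rfloor>" by (simp add: nat_eq_iff)
      then have "\<bar>u - v\<bar> \<le> 1" by linarith
      moreover have "u - v = (x $ j - y $ j) / h" by (simp add: u_def v_def diff_divide_distrib add_divide_distrib)
      ultimately show "\<bar>x $ j - y $ j\<bar> \<le> h" using h by (simp add: divide_le_eq)
    qed
    have Q_bounded: "bounded (Q f)" for f
      using \<open>bounded S\<close> by (rule bounded_subset) (auto simp: Q_def)
    have Q_diam: "diameter (Q f) \<le> C * h" for f
      using Q_close h C by (intro diameter_le) auto
    have cover: "S \<subseteq> (\<Union>f\<in>I. Q f)"
    proof
      fix x assume x: "x \<in> S"
      define f where "f = restrict (\<lambda>j. nat \<lfloor>(x $ j + R) / h\<rfloor>) J"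
      have "(x $ j + R) / h \<le> real N" for j
      proof -
        have "x $ j + R \<le> 2 * R" using comp[OF x, of j] by linarith
        then show ?thesis using h R(1) N_pos by (simp add: h_def field_simps mult_right_mono)
      qed
      then have "nat \<lfloor>(x $ j + R) / h\<rfloor> \<le> N" for j
        unfolding nat_le_iff floor_le_iff by (simp add: le_less_trans[OF _ less_add_one])
      then have "f \<in> I" unfolding f_def I_def by auto
      moreover have "x \<in> Q f" using x by (simp add: Q_def f_def)
      ultimately show "x \<in> (\<Union>f\<in>I. Q f)" by blast
    qed
    have weight: "hausdorff_weight s (Q f) \<le> ennreal (unit_ball_vol (real s) * (C * h / 2) ^ s)" for f
    proof (cases "Q f = {}")
      case False
      have "(diameter (Q f) / 2) ^ s \<le> (C * h / 2) ^ s"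
        using diameter_ge_0[OF Q_bounded, of f] Q_diam[of f] by (intro power_mono) auto
      then show ?thesis using False
        by (simp add: hausdorff_weight_def ennreal_leI mult_left_mono)
    qed simp
    have "hausdorff_pre s \<delta> S \<le> (\<Sum>f\<in>I. hausdorff_weight s (Q f))"
      using fin_I cover Q_bounded order_trans[OF Q_diam h(2)] that
      by (intro hausdorff_pre_finite_cover) auto
    also have "\<dots> \<le> of_nat (card I) * ennreal (unit_ball_vol (real s) * (C * h / 2) ^ s)"
      by (rule sum_bounded_above[OF weight])
    also have "\<dots> = ennreal (real (card I) * (unit_ball_vol (real s) * (C * h / 2) ^ s))"
      using C h by (simp add: ennreal_mult ennreal_of_nat_eq_real_of_nat)
    also have "\<dots> = ennreal (unit_ball_vol (real s) * ((real N + 1) / real N * C * R) ^ s)"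
    proof -
      have eq: "(real N + 1) / real N * C * R = (real N + 1) * (C * h / 2)" by (simp add: h_def)
      have "real (card I) = (real N + 1) ^ s" by (simp add: card_I add.commute)
      moreover have "((real N + 1) / real N * C * R) ^ s = (real N + 1) ^ s * (C * h / 2) ^ s"
        unfolding eq by (rule power_mult_distrib)
      ultimately show ?thesis by (simp only: ac_simps)
    qed
    also have "\<dots> \<le> ennreal K"
    proof -
      have "(real N + 1) / real N \<le> 2" using N_pos by (simp add: field_simps)
      then show ?thesis unfolding K_def using C R(1)
        by (intro ennreal_leI mult_left_mono power_mono mult_right_mono) auto
    qed
    finally show ?thesis .
  qed
  then have "hausdorff_outer s S \<le> ennreal K"
    unfolding hausdorff_outer_def by (intro SUP_least) auto
  then show ?thesis unfolding s_def using ennreal_less_top le_less_trans by blast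
qed

text \<open>If the diameter of \<open>U\<close> is below \<open>\<eta> < h\<close>, the tube is covered by at most \<open>5 h / \<eta>\<close> balls of radius \<open>2 \<eta>\<close>
  centred on the line through one point of \<open>U\<close>, which bounds its volume by a multiple of \<open>\<eta>\<close> to the power
  \<open>d - 1\<close>, where \<open>d\<close> is the dimension of the space. The tube itself may be nonmeasurable, whence the outer measure.\<close>

lemma outer_lebesgue_tube_le:
  fixes U :: "'a::euclidean_space set"
  assumes "bounded U" "norm \<nu> = 1" "diameter U < h"
  shows "outer_measure_of lborel {y. \<exists>t. \<bar>t\<bar> \<le> h \<and> y + t *\<^sub>R \<nu> \<in> U}
    \<le> ennreal (5 * h * unit_ball_vol (real DIM('a)) * 2 ^ DIM('a) * diameter U ^ (DIM('a) - 1))"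
    (is "outer_measure_of lborel ?tube \<le> ennreal (?K * _)")
proof (cases "U = {}")
  case False
  then obtain u where u: "u \<in> U" by blast
  have diam: "0 \<le> diameter U" by (rule diameter_ge_0[OF \<open>bounded U\<close>])
  have bound: "outer_measure_of lborel ?tube \<le> ennreal (?K * \<eta> ^ (DIM('a) - 1))"
    if \<eta>: "diameter U < \<eta>" "\<eta> < h" for \<eta>
  proof -
    have \<eta>0: "0 < \<eta>" using diam \<eta> by simp
    define m where "m = \<lceil>h / \<eta>\<rceil>"
    have m: "0 \<le> m" "real_of_int m \<le> 2 * (h / \<eta>)" "h / \<eta> \<le> m" "1 \<le> h / \<eta>"
    proof -
      show 1: "1 \<le> h / \<eta>" using \<eta> \<eta>0 by simp
      show "h / \<eta> \<le> m" by (simp add: m_def)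
      then show "0 \<le> m" using 1 by linarith
      show "real_of_int m \<le> 2 * (h / \<eta>)" unfolding m_def using 1 by linarith
    qed
    define B where "B = (\<Union>j\<in>{-m..m}. cball (u + (real_of_int j * \<eta>) *\<^sub>R \<nu>) (2 * \<eta>))"
    have "?tube \<subseteq> B"
    proof
      fix y assume "y \<in> ?tube"
      then obtain t where t: "\<bar>t\<bar> \<le> h" "y + t *\<^sub>R \<nu> \<in> U" by blast
      define j where "j = \<lfloor>- t / \<eta>\<rfloor>"
      have "\<bar>- t / \<eta>\<bar> \<le> h / \<eta>" using t \<eta>0 by (simp add: divide_right_mono)
      then have "\<bar>- t / \<eta>\<bar> \<le> m" using m by linarith
      then have "- real_of_int m \<le> - t / \<eta>" "- t / \<eta> \<le> m" by linarith+
      then have j: "j \<in> {-m..m}" unfolding j_def atLeastAtMost_iff by linarith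
      have "\<bar>- t / \<eta> - j\<bar> \<le> 1" unfolding j_def by linarith
      then have "\<bar>(- t / \<eta> - j) * \<eta>\<bar> \<le> 1 * \<eta>" using \<eta>0 by (simp only: abs_mult mult_right_mono abs_of_pos)
      moreover have "(- t / \<eta> - j) * \<eta> = - t - j * \<eta>" using \<eta>0 by (simp add: left_diff_distrib)
      ultimately have tj: "\<bar>- t - j * \<eta>\<bar> \<le> \<eta>" by simp
      have "dist (u + (real_of_int j * \<eta>) *\<^sub>R \<nu>) y = norm ((u - (y + t *\<^sub>R \<nu>)) - (- t - real_of_int j * \<eta>) *\<^sub>R \<nu>)"
        by (simp add: dist_norm algebra_simps)
      also have "\<dots> \<le> norm (u - (y + t *\<^sub>R \<nu>)) + \<bar>- t - j * \<eta>\<bar>"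
        using \<open>norm \<nu> = 1\<close> norm_triangle_ineq4[of "u - (y + t *\<^sub>R \<nu>)" "(- t - real_of_int j * \<eta>) *\<^sub>R \<nu>"]
        by simp
      also have "norm (u - (y + t *\<^sub>R \<nu>)) \<le> diameter U"
        using diameter_bounded_bound[OF \<open>bounded U\<close> u t(2)] by (simp add: dist_norm)
      finally have "dist (u + (real_of_int j * \<eta>) *\<^sub>R \<nu>) y \<le> 2 * \<eta>" using tj \<eta> by simp
      then show "y \<in> B" using j by (auto simp: B_def)
    qed
    then have "outer_measure_of lborel ?tube \<le> outer_measure_of lborel B" by (rule outer_measure_of_mono)
    also have "\<dots> = emeasure lborel B" unfolding B_def by (intro outer_measure_of_eq) auto
    also have "\<dots> \<le> (\<Sum>j\<in>{-m..m}. emeasure lborel (cball (u + (real_of_int j * \<eta>) *\<^sub>R \<nu>) (2 * \<eta>)))"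
      unfolding B_def by (intro emeasure_subadditive_finite) auto
    also have "\<dots> = of_nat (card {-m..m}) * ennreal (unit_ball_vol (real DIM('a)) * (2 * \<eta>) ^ DIM('a))"
      using \<eta>0 by (simp add: emeasure_cball)
    also have "\<dots> = ennreal (real (card {-m..m}) * (unit_ball_vol (real DIM('a)) * (2 * \<eta>) ^ DIM('a)))"
      using \<eta>0 by (simp add: ennreal_mult ennreal_of_nat_eq_real_of_nat)
    also have "\<dots> \<le> ennreal ((5 * (h / \<eta>)) * (unit_ball_vol (real DIM('a)) * (2 * \<eta>) ^ DIM('a)))"
    proof (intro ennreal_leI mult_right_mono)
      have "real (card {-m..m}) = 2 * real_of_int m + 1" using m by simp
      then show "real (card {-m..m}) \<le> 5 * (h / \<eta>)" using m by linarith
    qed (use \<eta>0 in simp)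
    also have "(5 * (h / \<eta>)) * (unit_ball_vol (real DIM('a)) * (2 * \<eta>) ^ DIM('a)) = ?K * \<eta> ^ (DIM('a) - 1)"
    proof -
      have "\<eta> ^ DIM('a) = \<eta> * \<eta> ^ (DIM('a) - 1)"
        using power_minus_mult[of "DIM('a)" \<eta>] by (simp add: mult.commute)
      then show ?thesis using \<eta>0 by (simp add: power_mult_distrib)
    qed
    finally show ?thesis .
  qed
  \<comment> \<open>Since the diameter may be 0, it cannot serve as radius itself; it is reached as a limit from above.\<close>
  show ?thesis
  proof (rule tendsto_lowerbound)
    show "((\<lambda>\<eta>. ennreal (?K * \<eta> ^ (DIM('a) - 1))) \<longlongrightarrow> ennreal (?K * diameter U ^ (DIM('a) - 1))) (at_right (diameter U))"
      by (intro tendsto_ennrealI tendsto_intros)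
    show "\<forall>\<^sub>F \<eta> in at_right (diameter U). outer_measure_of lborel ?tube \<le> ennreal (?K * \<eta> ^ (DIM('a) - 1))"
      unfolding eventually_at_right[OF \<open>diameter U < h\<close>] using bound \<open>diameter U < h\<close> by blast
  qed simp
qed simp

text \<open>A covering of \<open>S\<close> yields a covering of the ball by tubes, and the volume of each tube is at most \<open>K\<close> times
  the weight of the covering set. Coverings of small total weight would thus contradict the positive volume of
  the ball. Their diameters are at most \<open>h / 2\<close>, so that the bound on the volume of tubes of half-height \<open>h\<close>
  applies.\<close>

lemma hausdorff_outer_pos_if_tube:
  fixes S :: "'a::euclidean_space set"
  assumes "norm \<nu> = 1" "0 < h" "0 < \<epsilon>"
    and tube: "ball x \<epsilon> \<subseteq> {y. \<exists>t. \<bar>t\<bar> \<le> h \<and> y + t *\<^sub>R \<nu> \<in> S}"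
  shows "0 < hausdorff_outer (DIM('a) - 1) S"
proof (rule ccontr)
  let ?s = "DIM('a) - 1"
  define K where "K = 5 * h * unit_ball_vol (real DIM('a)) * 2 ^ DIM('a) * 2 ^ ?s / unit_ball_vol (real ?s)"
  have K: "K > 0" using \<open>0 < h\<close> by (simp add: K_def)
  define v where "v = unit_ball_vol (real DIM('a)) * \<epsilon> ^ DIM('a)"
  have v: "v > 0" using \<open>0 < \<epsilon>\<close> by (simp add: v_def)
  assume "\<not> 0 < hausdorff_outer ?s S"
  then have "hausdorff_pre ?s (h / 2) S = 0"
    using hausdorff_pre_le_outer[of "h / 2" ?s S] \<open>0 < h\<close> by simp
  then have "hausdorff_pre ?s (h / 2) S < ennreal (v / K)" using v K by simp
  then obtain U where U: "S \<subseteq> (\<Union>i::nat. U i)" "\<And>i. bounded (U i)" "\<And>i. diameter (U i) \<le> h / 2"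
    and small: "(\<Sum>i. hausdorff_weight ?s (U i)) < ennreal (v / K)"
    using hausdorff_pre_lessE by metis
  define tube where "tube i = {y. \<exists>t. \<bar>t\<bar> \<le> h \<and> y + t *\<^sub>R \<nu> \<in> U i}" for i
  have "outer_measure_of lborel (tube i) \<le> ennreal K * hausdorff_weight ?s (U i)" for i
  proof (cases "U i = {}")
    case True then show ?thesis by (simp add: tube_def)
  next
    case False
    have "outer_measure_of lborel (tube i)
      \<le> ennreal (5 * h * unit_ball_vol (real DIM('a)) * 2 ^ DIM('a) * diameter (U i) ^ ?s)"
      unfolding tube_def using U(2) U(3)[of i] \<open>norm \<nu> = 1\<close> \<open>0 < h\<close> by (intro outer_lebesgue_tube_le) auto
    also have "5 * h * unit_ball_vol (real DIM('a)) * 2 ^ DIM('a) * diameter (U i) ^ ?s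
        = K * (unit_ball_vol (real ?s) * (diameter (U i) / 2) ^ ?s)"
      by (simp add: K_def power_divide less_imp_neq[OF unit_ball_vol_pos, symmetric])
    finally show ?thesis using K False
      by (simp add: hausdorff_weight_def ennreal_mult diameter_ge_0[OF U(2)])
  qed
  moreover have "\<forall>i. \<exists>E\<in>sets lborel. tube i \<subseteq> E \<and> outer_measure_of lborel (tube i) = emeasure lborel E"
    by (intro allI outer_measure_of_attain) simp
  then obtain E where E: "\<And>i. E i \<in> sets lborel" "\<And>i. tube i \<subseteq> E i"
      "\<And>i. outer_measure_of lborel (tube i) = emeasure lborel (E i)" by metis
  ultimately have E_le: "emeasure lborel (E i) \<le> ennreal K * hausdorff_weight ?s (U i)" for i by metis
  have "ball x \<epsilon> \<subseteq> (\<Union>i. E i)"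
  proof
    fix y assume "y \<in> ball x \<epsilon>"
    then obtain t where "\<bar>t\<bar> \<le> h" "y + t *\<^sub>R \<nu> \<in> S" using tube by blast
    then obtain i where "y + t *\<^sub>R \<nu> \<in> U i" using U(1) by blast
    then have "y \<in> tube i" using \<open>\<bar>t\<bar> \<le> h\<close> by (auto simp: tube_def)
    then show "y \<in> (\<Union>i. E i)" using E(2) by blast
  qed
  then have "emeasure lborel (ball x \<epsilon>) \<le> emeasure lborel (\<Union>i. E i)"
    using E(1) by (intro emeasure_mono) auto
  also have "\<dots> \<le> (\<Sum>i. emeasure lborel (E i))"
    using E(1) by (intro emeasure_subadditive_countably) auto
  also have "\<dots> \<le> (\<Sum>i. ennreal K * hausdorff_weight ?s (U i))"
    by (intro suminf_le allI E_le) auto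
  also have "\<dots> = ennreal K * (\<Sum>i. hausdorff_weight ?s (U i))" by (rule ennreal_suminf_cmult)
  also have "\<dots> < ennreal K * ennreal (v / K)"
    using small K by (intro ennreal_mult_strict_left_mono) auto
  also have "\<dots> = ennreal v" using K v by (simp add: ennreal_mult[symmetric])
  also have "\<dots> = emeasure lborel (ball x \<epsilon>)"
    using \<open>0 < \<epsilon>\<close> by (simp add: emeasure_ball v_def)
  finally show False by simp
qed

text \<open>In graph coordinates at \<open>x\<close>, the point \<open>x + s \<nu>\<close> lies in the open set \<open>D\<close> and \<open>x - s \<nu>\<close> in an open set disjoint
  from \<open>D\<close>. For every \<open>y\<close> near \<open>x\<close> the segment from \<open>y - s \<nu>\<close> to \<open>y + s \<nu>\<close> must therefore cross the boundary,
  so the vertical tube over the boundary fills a ball around \<open>x\<close>.\<close>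

lemma hausdorff_outer_lipschitz_frontier_pos:
  fixes D :: "'a::euclidean_space set"
  assumes D: "lipschitz_domain D" and x: "x \<in> frontier D" and "0 < r"
  shows "0 < hausdorff_outer (DIM('a) - 1) (frontier D \<inter> ball x r)"
proof -
  have "open D" using D by (simp add: lipschitz_domain_def)
  obtain \<nu> \<phi> L U where \<nu>: "norm \<nu> = 1" and lip: "L-lipschitz_on UNIV (\<phi> :: 'a \<Rightarrow> real)"
    and U: "open U" "x \<in> U" and graph: "\<And>y. y \<in> U \<Longrightarrow> y \<in> D \<longleftrightarrow> \<phi> (y - (y \<bullet> \<nu>) *\<^sub>R \<nu>) < y \<bullet> \<nu>"
    using D x unfolding lipschitz_domain_def by blast
  \<comment> \<open>The signed height above the graph; within U it is positive exactly on D.\<close>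
  define g where "g y = y \<bullet> \<nu> - \<phi> (y - (y \<bullet> \<nu>) *\<^sub>R \<nu>)" for y
  have in_D: "y \<in> D \<longleftrightarrow> 0 < g y" if "y \<in> U" for y using graph[OF that] by (simp add: g_def)
  have cont_g: "continuous_on UNIV g"
    unfolding g_def
    by (intro continuous_intros continuous_on_compose2[OF lipschitz_on_continuous_on[OF lip]]) auto
  have below: "open (U \<inter> {y. g y < 0})"
    using U(1) cont_g by (intro open_Int open_Collect_less) (auto intro: continuous_intros)
  have gx: "g x = 0"
  proof (rule ccontr)
    assume "g x \<noteq> 0"
    moreover have "x \<notin> D" using x \<open>open D\<close> by (simp add: frontier_def interior_open)
    ultimately have "x \<in> U \<inter> {y. g y < 0}" using in_D[OF U(2)] U(2) by auto
    then have "D \<inter> (U \<inter> {y. g y < 0}) \<noteq> {}"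
      using x below open_Int_closure_eq_empty[OF below, of D] by (auto simp: frontier_def)
    then show False using in_D by force
  qed
  have shift: "g (x + t *\<^sub>R \<nu>) = t" for t
  proof -
    have "\<nu> \<bullet> \<nu> = 1" using \<nu> by (simp add: norm_eq_1)
    then have "g (x + t *\<^sub>R \<nu>) = g x + t" by (simp add: g_def algebra_simps)
    then show ?thesis using gx by simp
  qed
  obtain \<rho> where \<rho>: "0 < \<rho>" "ball x \<rho> \<subseteq> U" using U by (meson open_contains_ball)
  define s where "s = min \<rho> r / 3"
  have s: "0 < s" "s < \<rho>" "2 * s < r" using \<rho>(1) \<open>0 < r\<close> by (auto simp: s_def)
  have "x + t *\<^sub>R \<nu> \<in> U" if "\<bar>t\<bar> \<le> s" for t
    using that s \<nu> by (intro subsetD[OF \<rho>(2)]) (simp add: dist_norm)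
  then have up: "x + s *\<^sub>R \<nu> \<in> D" and down: "x + (- s) *\<^sub>R \<nu> \<in> U \<inter> {y. g y < 0}"
    using s in_D shift[of s] shift[of "- s"] by (auto simp del: scaleR_minus_left)
  obtain \<epsilon>1 where \<epsilon>1: "0 < \<epsilon>1" "ball (x + s *\<^sub>R \<nu>) \<epsilon>1 \<subseteq> D"
    using up \<open>open D\<close> by (meson open_contains_ball)
  obtain \<epsilon>2 where \<epsilon>2: "0 < \<epsilon>2" "ball (x + (- s) *\<^sub>R \<nu>) \<epsilon>2 \<subseteq> U \<inter> {y. g y < 0}"
    using down below by (meson open_contains_ball)
  define \<epsilon> where "\<epsilon> = min s (min \<epsilon>1 \<epsilon>2)"
  show ?thesis
  proof (rule hausdorff_outer_pos_if_tube[OF \<nu>])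
    show "0 < s" "0 < \<epsilon>" using s \<epsilon>1 \<epsilon>2 by (auto simp: \<epsilon>_def)
    show "ball x \<epsilon> \<subseteq> {y. \<exists>t. \<bar>t\<bar> \<le> s \<and> y + t *\<^sub>R \<nu> \<in> frontier D \<inter> ball x r}"
    proof
      fix y assume y: "y \<in> ball x \<epsilon>"
      have "dist (x + t *\<^sub>R \<nu>) (y + t *\<^sub>R \<nu>) = dist x y" for t by (simp add: dist_norm)
      then have "y + s *\<^sub>R \<nu> \<in> ball (x + s *\<^sub>R \<nu>) \<epsilon>1" "y + (- s) *\<^sub>R \<nu> \<in> ball (x + (- s) *\<^sub>R \<nu>) \<epsilon>2"
        using y by (auto simp: \<epsilon>_def simp del: scaleR_minus_left)
      then have in1: "y + s *\<^sub>R \<nu> \<in> D" and "y + (- s) *\<^sub>R \<nu> \<in> U \<inter> {y. g y < 0}"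
        using \<epsilon>1(2) \<epsilon>2(2) by blast+
      then have in2: "y + (- s) *\<^sub>R \<nu> \<notin> D" using in_D by force
      have "closed_segment (y + (- s) *\<^sub>R \<nu>) (y + s *\<^sub>R \<nu>) \<inter> frontier D \<noteq> {}"
        using in1 in2 by (intro connected_Int_frontier) (auto simp del: scaleR_minus_left)
      then obtain z where z: "z \<in> closed_segment (y + (- s) *\<^sub>R \<nu>) (y + s *\<^sub>R \<nu>)" "z \<in> frontier D" by blast
      then obtain u where u: "0 \<le> u" "u \<le> 1" "z = (1 - u) *\<^sub>R (y + (- s) *\<^sub>R \<nu>) + u *\<^sub>R (y + s *\<^sub>R \<nu>)"
        by (auto simp: closed_segment_def)
      define t where "t = (2 * u - 1) * s"
      have "z = y + t *\<^sub>R \<nu>" unfolding u(3) t_def by (simp add: algebra_simps flip: scaleR_2)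
      moreover have t: "\<bar>t\<bar> \<le> s" using u s mult_right_mono[of "\<bar>2 * u - 1\<bar>" 1 s]
        by (simp add: t_def abs_mult)
      moreover have "y + t *\<^sub>R \<nu> \<in> ball x r"
      proof -
        have "dist x (y + t *\<^sub>R \<nu>) \<le> dist x y + norm (t *\<^sub>R \<nu>)"
          using dist_triangle[of x "y + t *\<^sub>R \<nu>" y] by (simp add: dist_norm)
        also have "\<dots> < s + s" using y t \<nu> by (auto simp: \<epsilon>_def)
        finally show ?thesis using s by simp
      qed
      ultimately show "y \<in> {y. \<exists>t. \<bar>t\<bar> \<le> s \<and> y + t *\<^sub>R \<nu> \<in> frontier D \<inter> ball x r}" using z(2) by blast
    qed
  qed
qed

section \<open>Norms from definite Hermitian forms, subspaces and products\<close>

lemma vector_space_scale_fun: "vector_space scale_fun"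
  by unfold_locales (auto simp: scale_fun_def fun_eq_iff algebra_simps)

lemma vector_space_scale_tuple: "vector_space scale_tuple"
  by unfold_locales (auto simp: scale_tuple_def scale_fun_def fun_eq_iff algebra_simps)

interpretation scale_fun: vector_space scale_fun
  by (rule vector_space_scale_fun)

interpretation scale_tuple: vector_space scale_tuple
  by (rule vector_space_scale_tuple)

locale definite_hermitian_form = vector_space scl
  for scl :: "complex \<Rightarrow> 'v::ab_group_add \<Rightarrow> 'v" +
  fixes W :: "'v set" and H :: "'v \<Rightarrow> 'v \<Rightarrow> complex"
  assumes subspace_W: "subspace W"
    and add_left: "\<lbrakk>u \<in> W; v \<in> W; w \<in> W\<rbrakk> \<Longrightarrow> H (u + v) w = H u w + H v w"
    and scale_left: "\<lbrakk>u \<in> W; w \<in> W\<rbrakk> \<Longrightarrow> H (scl c u) w = c * H u w"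
    and hermitian: "\<lbrakk>u \<in> W; w \<in> W\<rbrakk> \<Longrightarrow> H u w = cnj (H w u)"
    and definite: "\<lbrakk>u \<in> W; u \<noteq> 0\<rbrakk> \<Longrightarrow> 0 < Re (H u u)"
begin

lemma add_right: "\<lbrakk>u \<in> W; v \<in> W; w \<in> W\<rbrakk> \<Longrightarrow> H w (u + v) = H w u + H w v"
  using add_left[of u v w] hermitian subspace_add[OF subspace_W]
  by (metis complex_cnj_add)

lemma scale_right: "\<lbrakk>u \<in> W; w \<in> W\<rbrakk> \<Longrightarrow> H w (scl c u) = cnj c * H w u"
  using scale_left[of u w c] hermitian subspace_scale[OF subspace_W]
  by (metis complex_cnj_mult)

lemma zero_left: "w \<in> W \<Longrightarrow> H 0 w = 0"
  using scale_left[of 0 w 0] subspace_0[OF subspace_W] by simp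

lemma diff_left: "\<lbrakk>u \<in> W; v \<in> W; w \<in> W\<rbrakk> \<Longrightarrow> H (u - v) w = H u w - H v w"
  using add_left[of "u - v" v w] subspace_diff[OF subspace_W, of u v] by simp

lemma eq_if_form_eq:
  assumes "u \<in> W" "v \<in> W" and eq: "\<And>w. w \<in> W \<Longrightarrow> H u w = H v w"
  shows "u = v"
proof (rule ccontr)
  assume "u \<noteq> v"
  have "u - v \<in> W" using assms subspace_diff[OF subspace_W] by blast
  then have "H (u - v) (u - v) = 0" using diff_left[of u v "u - v"] assms by simp
  then show False using definite[of "u - v"] \<open>u - v \<in> W\<close> \<open>u \<noteq> v\<close> by simp
qed

text \<open>The representing vector is built by induction over a finite spanning set. To accommodate a new vector \<open>b\<close>, subtract
  from it the vector \<open>q\<close> in the old span that represents \<open>H b\<close>: the difference \<open>r\<close> is orthogonal to the old vectors,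
  and a multiple of it corrects the value at \<open>b\<close>.\<close>

lemma riesz_representation:
  assumes "finite S" "W \<subseteq> span S"
    and add: "\<And>u v. \<lbrakk>u \<in> W; v \<in> W\<rbrakk> \<Longrightarrow> F (u + v) = F u + F v"
    and scale: "\<And>c u. u \<in> W \<Longrightarrow> F (scl c u) = cnj c * F u"
  shows "\<exists>g\<in>W. \<forall>w\<in>W. H g w = F w"
proof -
  obtain B where B: "B \<subseteq> W" "independent B" "W \<subseteq> span B"
    using maximal_independent_subset by blast
  have "finite B" using independent_span_bound[OF \<open>finite S\<close> B(2)] B(1) \<open>W \<subseteq> span S\<close> by blast
  \<comment> \<open>Two antilinear functionals that agree on C agree on its span.\<close>
  have agree: "H g w = G w"
    if "w \<in> span C" "C \<subseteq> W" "g \<in> W" "\<forall>b\<in>C. H g b = G b"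
      and G: "\<And>u v. \<lbrakk>u \<in> W; v \<in> W\<rbrakk> \<Longrightarrow> G (u + v) = G u + G v" "\<And>c u. u \<in> W \<Longrightarrow> G (scl c u) = cnj c * G u"
    for G C g w
  proof -
    have "subspace {w \<in> W. H g w = G w}"
    proof (rule subspaceI)
      show "0 \<in> {w \<in> W. H g w = G w}"
        using subspace_0[OF subspace_W] \<open>g \<in> W\<close> G(2)[of 0 0] scale_right[of 0 g 0] by simp
    qed (use subspace_add[OF subspace_W] subspace_scale[OF subspace_W] \<open>g \<in> W\<close> G add_right scale_right in auto)
    then have "span C \<subseteq> {w \<in> W. H g w = G w}"
      using that by (intro span_minimal) auto
    then show ?thesis using \<open>w \<in> span C\<close> by blast
  qed
  have on_finite: "\<exists>g\<in>span C. \<forall>b\<in>C. H g b = G b"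
    if "finite C" "C \<subseteq> W" and G: "\<And>u v. \<lbrakk>u \<in> W; v \<in> W\<rbrakk> \<Longrightarrow> G (u + v) = G u + G v"
      "\<And>c u. u \<in> W \<Longrightarrow> G (scl c u) = cnj c * G u" for C G
    using that
  proof (induction C arbitrary: G rule: finite_induct)
    case (insert b C)
    have bW: "b \<in> W" and CW: "C \<subseteq> W" using insert.prems(1) by auto
    have span_W: "span C \<subseteq> W" using CW by (intro span_minimal subspace_W)
    obtain g where g: "g \<in> span C" "\<forall>c\<in>C. H g c = G c" using insert.IH[of G] insert.prems by auto
    obtain q where q: "q \<in> span C" "\<forall>c\<in>C. H q c = H b c"
      using insert.IH[of "H b"] CW bW add_right scale_right by auto
    have gW: "g \<in> W" and qW: "q \<in> W" using g q span_W by auto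
    define r where "r = b - q"
    have rW: "r \<in> W" unfolding r_def using bW qW subspace_diff[OF subspace_W] by blast
    have r_C: "H r c = 0" if "c \<in> C" for c
      using that q(2) diff_left[of b q c] bW qW CW by (auto simp: r_def)
    have span_C: "span C \<subseteq> span (insert b C)" by (rule span_mono) auto
    then have r_span: "r \<in> span (insert b C)"
      unfolding r_def using q(1) by (intro span_diff) (auto intro: span_base)
    show ?case
    proof (cases "r = 0")
      case True
      then have "b \<in> span C" using q(1) by (simp add: r_def)
      then have "H g b = G b" using agree[of b C g G] CW gW g(2) insert.prems by blast
      then show ?thesis using g span_C by auto
    next
      case False
      have "H r q = 0" using agree[of q C r "\<lambda>_. 0"] q(1) CW rW r_C by simp
      moreover have "H r b = H r r + H r q"
        using add_right[of r q r] rW qW by (simp add: r_def)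
      ultimately have "H r b \<noteq> 0" using definite[OF rW False] by auto
      define c where "c = (G b - H g b) / H r b"
      have *: "H (g + scl c r) w = H g w + c * H r w" if "w \<in> W" for w
        using add_left[of g "scl c r" w] scale_left[of r w c] subspace_scale[OF subspace_W rW] gW rW that
        by simp
      have "H (g + scl c r) x = G x" if "x \<in> insert b C" for x
        using that * bW CW g(2) r_C \<open>H r b \<noteq> 0\<close> by (auto simp: c_def)
      moreover have "g + scl c r \<in> span (insert b C)"
        using g(1) r_span span_C by (intro span_add span_scale) auto
      ultimately show ?thesis by blast
    qed
  qed (auto simp: span_zero)
  obtain g where g: "g \<in> span B" "\<forall>b\<in>B. H g b = F b"
    using on_finite[OF \<open>finite B\<close> B(1)] add scale by blast
  then have "g \<in> W" using span_minimal[OF B(1) subspace_W] by blast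
  then show ?thesis using agree[of _ B g F] B g(2) add scale by blast
qed

lemma self_nonneg: "u \<in> W \<Longrightarrow> 0 \<le> Re (H u u)"
  using definite[of u] zero_left[of 0] subspace_0[OF subspace_W] by (cases "u = 0") auto

text \<open>Expand the nonnegative quantity \<open>H x x\<close> for \<open>x = b u - a v\<close>, where \<open>a\<close> and \<open>b\<close> are the norms of \<open>u\<close> and \<open>v\<close>.\<close>

lemma Re_le_norm_mult:
  assumes "u \<in> W" "v \<in> W"
  shows "Re (H u v) \<le> sqrt (Re (H u u)) * sqrt (Re (H v v))"
proof (cases "u = 0 \<or> v = 0")
  case True
  then have "H u v = 0" using zero_left[OF \<open>v \<in> W\<close>] zero_left[OF \<open>u \<in> W\<close>] hermitian[OF assms] by auto
  then show ?thesis using assms self_nonneg by simp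
next
  case False
  define a b where "a = sqrt (Re (H u u))" and "b = sqrt (Re (H v v))"
  have pos: "a > 0" "b > 0" using definite assms False by (auto simp: a_def b_def)
  have sq: "Re (H u u) = a\<^sup>2" "Re (H v v) = b\<^sup>2"
    using self_nonneg assms by (auto simp: a_def b_def)
  let ?x = "scl (of_real b) u" and ?y = "scl (of_real a) v"
  have xy: "?x \<in> W" "?y \<in> W" "?x - ?y \<in> W"
    using assms subspace_scale[OF subspace_W] subspace_diff[OF subspace_W] by blast+
  have uminus: "H w (?x - ?y) = H w ?x - H w ?y" if "w \<in> W" for w
    using add_right[of "?x - ?y" ?y w] xy that by simp
  have "0 \<le> Re (H (?x - ?y) (?x - ?y))" using xy by (intro self_nonneg)
  also have "H (?x - ?y) (?x - ?y) = H ?x ?x - H ?x ?y - H ?y ?x + H ?y ?y"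
    using xy by (simp add: diff_left uminus)
  also have "\<dots> = of_real (b * b) * H u u - of_real (a * b) * (H u v + H v u) + of_real (a * a) * H v v"
    using assms xy by (simp add: scale_left scale_right algebra_simps)
  also have "Re \<dots> = 2 * (a * b) * (a * b - Re (H u v))"
    using hermitian[OF assms] by (simp add: sq power2_eq_square algebra_simps)
  finally have "0 \<le> a * b - Re (H u v)"
    using mult_pos_pos[OF pos] by (auto simp: zero_le_mult_iff)
  then show ?thesis by (simp add: a_def b_def)
qed

lemma norm_on_form_norm: "norm_on scl W (\<lambda>u. sqrt (Re (H u u)))"
  unfolding norm_on_def
proof (intro conjI ballI allI)
  show "vector_space scl" by (rule vector_space_axioms)
  show "subspace W" by (rule subspace_W)
next
  fix u assume u: "u \<in> W"
  show "0 \<le> sqrt (Re (H u u))" using self_nonneg u by simp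
  show "sqrt (Re (H u u)) = 0 \<longleftrightarrow> u = 0"
    using definite[OF u] zero_left[OF u] by (cases "u = 0") auto
next
  fix c u assume u: "u \<in> W"
  then have "H (scl c u) (scl c u) = (c * cnj c) * H u u"
    using subspace_scale[OF subspace_W] by (simp add: scale_left scale_right)
  then have "Re (H (scl c u) (scl c u)) = (cmod c)\<^sup>2 * Re (H u u)"
    by (simp flip: complex_norm_square)
  then show "sqrt (Re (H (scl c u) (scl c u))) = cmod c * sqrt (Re (H u u))"
    by (simp add: real_sqrt_mult)
next
  fix u v assume uv: "u \<in> W" "v \<in> W"
  then have "u + v \<in> W" using subspace_add[OF subspace_W] by blast
  then have "H (u + v) (u + v) = H u u + H v v + (H u v + H v u)"
    using uv by (simp add: add_left add_right)
  then have "Re (H (u + v) (u + v)) = Re (H u u) + Re (H v v) + 2 * Re (H u v)"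
    using hermitian[OF uv] by simp
  also have "\<dots> \<le> (sqrt (Re (H u u)) + sqrt (Re (H v v)))\<^sup>2"
    using Re_le_norm_mult[OF uv] self_nonneg uv by (simp add: power2_sum)
  finally show "sqrt (Re (H (u + v) (u + v))) \<le> sqrt (Re (H u u)) + sqrt (Re (H v v))"
    using self_nonneg uv by (intro real_le_lsqrt) auto
qed

end

lemma norm_on_pullback:
  assumes N: "norm_on scl W N" and V: "vector_space scl'" "module.subspace scl' V"
    and J: "\<And>u. u \<in> V \<Longrightarrow> J u \<in> W"
    and add: "\<And>u v. \<lbrakk>u \<in> V; v \<in> V\<rbrakk> \<Longrightarrow> J (u + v) = J u + J v"
    and scale: "\<And>c u. u \<in> V \<Longrightarrow> J (scl' c u) = scl c (J u)"
    and zero: "\<And>u. u \<in> V \<Longrightarrow> J u = 0 \<longleftrightarrow> u = 0"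
  shows "norm_on scl' V (\<lambda>u. N (J u))"
  using assms unfolding norm_on_def by auto

lemma norm_on_l2_product:
  fixes Nl :: "nat \<Rightarrow> ('a \<Rightarrow> complex) \<Rightarrow> real"
  assumes "finite I" and N: "\<And>l. l \<in> I \<Longrightarrow> norm_on scale_fun (V l) (Nl l)"
  shows "norm_on scale_tuple {w. (\<forall>l\<in>I. w l \<in> V l) \<and> (\<forall>l. l \<notin> I \<longrightarrow> w l = 0)}
    (\<lambda>w. sqrt (\<Sum>l\<in>I. (Nl l (w l))\<^sup>2))"
    (is "norm_on _ ?P ?N")
  unfolding norm_on_def
proof (intro conjI ballI allI)
  have sub: "scale_fun.subspace (V l)" if "l \<in> I" for l using N[OF that] by (simp add: norm_on_def)
  show "vector_space scale_tuple" by (rule vector_space_scale_tuple)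
  show "scale_tuple.subspace ?P"
    using sub by (intro scale_tuple.subspaceI)
      (auto simp: scale_tuple_def scale_fun.subspace_0 scale_fun.subspace_add scale_fun.subspace_scale)
next
  fix u assume "u \<in> ?P"
  then have u: "u l \<in> V l" "0 \<le> Nl l (u l)" "Nl l (u l) = 0 \<longleftrightarrow> u l = 0" if "l \<in> I" for l
    using N[OF that] that by (auto simp: norm_on_def)
  show "0 \<le> ?N u" by (simp add: sum_nonneg)
  show "?N u = 0 \<longleftrightarrow> u = 0"
    using u(3) \<open>u \<in> ?P\<close> \<open>finite I\<close> by (auto simp: sum_nonneg_eq_0_iff fun_eq_iff)
next
  fix c u assume "u \<in> ?P"
  then have "Nl l (scale_tuple c u l) = cmod c * Nl l (u l)" if "l \<in> I" for l
    using N[OF that] that by (auto simp: norm_on_def scale_tuple_def)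
  then have "(\<Sum>l\<in>I. (Nl l (scale_tuple c u l))\<^sup>2) = (cmod c)\<^sup>2 * (\<Sum>l\<in>I. (Nl l (u l))\<^sup>2)"
    by (simp add: power_mult_distrib sum_distrib_left)
  then show "?N (scale_tuple c u) = cmod c * ?N u" by (simp add: real_sqrt_mult)
next
  fix u v assume uv: "u \<in> ?P" "v \<in> ?P"
  have le: "Nl l ((u + v) l) \<le> Nl l (u l) + Nl l (v l)" and nonneg: "0 \<le> Nl l ((u + v) l)" if l: "l \<in> I" for l
  proof -
    have "u l \<in> V l" "v l \<in> V l" using uv l by auto
    moreover from this have "u l + v l \<in> V l"
      using N[OF l] scale_fun.subspace_add by (auto simp: norm_on_def)
    ultimately show "Nl l ((u + v) l) \<le> Nl l (u l) + Nl l (v l)" "0 \<le> Nl l ((u + v) l)"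
      using N[OF l] by (auto simp: norm_on_def)
  qed
  have "L2_set (\<lambda>l. Nl l ((u + v) l)) I \<le> L2_set (\<lambda>l. Nl l (u l) + Nl l (v l)) I"
    by (rule L2_set_mono[OF le nonneg])
  also have "\<dots> \<le> L2_set (\<lambda>l. Nl l (u l)) I + L2_set (\<lambda>l. Nl l (v l)) I"
    by (rule L2_set_triangle_ineq)
  finally show "?N (u + v) \<le> ?N u + ?N v" by (simp add: L2_set_def)
qed

section \<open>Finite element spaces\<close>

lemma finite_multi_indices: "finite {\<alpha> :: 'n::finite \<Rightarrow> nat. (\<Sum>i\<in>UNIV. \<alpha> i) \<le> p}"
proof (rule finite_subset)
  show "{\<alpha> :: 'n \<Rightarrow> nat. (\<Sum>i\<in>UNIV. \<alpha> i) \<le> p} \<subseteq> (\<Pi>\<^sub>E i\<in>UNIV. {..p})"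
  proof
    fix \<alpha> :: "'n \<Rightarrow> nat" assume "\<alpha> \<in> {\<alpha>. (\<Sum>i\<in>UNIV. \<alpha> i) \<le> p}"
    then have "\<alpha> i \<le> p" for i using member_le_sum[of i UNIV \<alpha>] by simp
    then show "\<alpha> \<in> (\<Pi>\<^sub>E i\<in>UNIV. {..p})" by auto
  qed
qed (rule finite_PiE, auto)

lemma subspace_polynomials_total_degree: "scale_fun.subspace (polynomials_total_degree p)"
proof (rule scale_fun.subspaceI)
  show "0 \<in> polynomials_total_degree p"
    by (auto simp: polynomials_total_degree_def fun_eq_iff intro!: exI[of _ "\<lambda>_. 0"])
next
  fix u v :: "real^'n \<Rightarrow> complex"
  assume "u \<in> polynomials_total_degree p" "v \<in> polynomials_total_degree p"
  then obtain a b
    where "u = (\<lambda>x. \<Sum>\<alpha> | (\<Sum>i\<in>UNIV. \<alpha> i) \<le> p. a \<alpha> * (\<Prod>i\<in>UNIV. of_real (x $ i) ^ \<alpha> i))"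
      and "v = (\<lambda>x. \<Sum>\<alpha> | (\<Sum>i\<in>UNIV. \<alpha> i) \<le> p. b \<alpha> * (\<Prod>i\<in>UNIV. of_real (x $ i) ^ \<alpha> i))"
    unfolding polynomials_total_degree_def by blast
  then show "u + v \<in> polynomials_total_degree p"
    unfolding polynomials_total_degree_def
    by (intro CollectI exI[of _ "\<lambda>\<alpha>. a \<alpha> + b \<alpha>"]) (simp add: fun_eq_iff sum.distrib ring_distribs)
next
  fix c and u :: "real^'n \<Rightarrow> complex"
  assume "u \<in> polynomials_total_degree p"
  then obtain a
    where "u = (\<lambda>x. \<Sum>\<alpha> | (\<Sum>i\<in>UNIV. \<alpha> i) \<le> p. a \<alpha> * (\<Prod>i\<in>UNIV. of_real (x $ i) ^ \<alpha> i))"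
    unfolding polynomials_total_degree_def by blast
  then show "scale_fun c u \<in> polynomials_total_degree p"
    unfolding polynomials_total_degree_def
    by (intro CollectI exI[of _ "\<lambda>\<alpha>. c * a \<alpha>"]) (simp add: scale_fun_def fun_eq_iff sum_distrib_left mult.assoc)
qed

lemma subspace_fe_space: "scale_fun.subspace (fe_space \<Omega> T p)"
proof (rule scale_fun.subspaceI)
  show "0 \<in> fe_space \<Omega> T p"
    using scale_fun.subspace_0[OF subspace_polynomials_total_degree]
    by (auto simp: fe_space_def zero_fun_def intro!: continuous_intros bexI[of _ "\<lambda>_. 0"])
next
  fix u v assume uv: "u \<in> fe_space \<Omega> T p" "v \<in> fe_space \<Omega> T p"
  have "\<exists>q\<in>polynomials_total_degree p. \<forall>x\<in>K. (u + v) x = q x" if K: "K \<in> T" for K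
  proof -
    obtain q r where "q \<in> polynomials_total_degree p" "\<forall>x\<in>K. u x = q x"
        "r \<in> polynomials_total_degree p" "\<forall>x\<in>K. v x = r x"
      using uv K unfolding fe_space_def by blast
    then show ?thesis
      using scale_fun.subspace_add[OF subspace_polynomials_total_degree] by (intro bexI[of _ "q + r"]) auto
  qed
  then show "u + v \<in> fe_space \<Omega> T p"
    using uv by (auto simp: fe_space_def plus_fun_def intro!: continuous_intros)
next
  fix c u assume u: "u \<in> fe_space \<Omega> T p"
  have "\<exists>q\<in>polynomials_total_degree p. \<forall>x\<in>K. scale_fun c u x = q x" if K: "K \<in> T" for K
  proof -
    obtain q where "q \<in> polynomials_total_degree p" "\<forall>x\<in>K. u x = q x"
      using u K unfolding fe_space_def by blast
    then show ?thesis
      using scale_fun.subspace_scale[OF subspace_polynomials_total_degree]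
      by (intro bexI[of _ "scale_fun c q"]) (auto simp: scale_fun_def)
  qed
  then show "scale_fun c u \<in> fe_space \<Omega> T p"
    using u by (auto simp: fe_space_def scale_fun_def intro!: continuous_intros)
qed

lemma restrict_to_add: "restrict_to S (u + v) = restrict_to S u + restrict_to S v"
  by (auto simp: restrict_to_def)

lemma restrict_to_scale: "restrict_to S (scale_fun c u) = scale_fun c (restrict_to S u)"
  by (auto simp: restrict_to_def scale_fun_def)

lemma restrict_to_restrict_to: "S \<subseteq> S' \<Longrightarrow> restrict_to S (restrict_to S' v) = restrict_to S v"
  by (auto simp: restrict_to_def fun_eq_iff)

lemma restrict_to_zero_iff: "restrict_to S v = 0 \<longleftrightarrow> (\<forall>x\<in>S. v x = 0)"
  by (auto simp: restrict_to_def fun_eq_iff)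

lemma subspace_fe_restriction: "scale_fun.subspace (fe_restriction \<Omega> T p S)"
proof (rule scale_fun.subspaceI)
  have "restrict_to S 0 = 0" by (simp add: restrict_to_zero_iff)
  then show "0 \<in> fe_restriction \<Omega> T p S"
    using scale_fun.subspace_0[OF subspace_fe_space] unfolding fe_restriction_def by force
next
  fix u v assume "u \<in> fe_restriction \<Omega> T p S" "v \<in> fe_restriction \<Omega> T p S"
  then show "u + v \<in> fe_restriction \<Omega> T p S"
    unfolding fe_restriction_def
    by (auto simp flip: restrict_to_add intro!: imageI scale_fun.subspace_add[OF subspace_fe_space])
next
  fix c u assume "u \<in> fe_restriction \<Omega> T p S"
  then show "scale_fun c u \<in> fe_restriction \<Omega> T p S"
    unfolding fe_restriction_def
    by (auto simp flip: restrict_to_scale intro!: imageI scale_fun.subspace_scale[OF subspace_fe_space])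
qed

lemma continuous_on_fe_restriction:
  assumes "v \<in> fe_restriction \<Omega> T p S'" "S \<subseteq> S'" "S \<subseteq> closure \<Omega>"
  shows "continuous_on S v"
proof -
  obtain u where u: "u \<in> fe_space \<Omega> T p" "v = restrict_to S' u"
    using assms(1) by (auto simp: fe_restriction_def)
  have "continuous_on S u" using u(1) assms(3) continuous_on_subset by (auto simp: fe_space_def)
  moreover have "u x = v x" if "x \<in> S" for x using u(2) that assms(2) by (auto simp: restrict_to_def)
  ultimately show ?thesis by (simp cong: continuous_on_cong)
qed

lemma sum_fun_apply: "(\<Sum>i\<in>I. f i) x = (\<Sum>i\<in>I. f i x)"
  for f :: "'i \<Rightarrow> 'a \<Rightarrow> complex"
  by (induction I rule: infinite_finite_induct) auto

text \<open>Choose for each point \<open>x\<close> of the mesh one simplex \<open>\<kappa> x\<close> containing it. The monomials cut off to the disjoint sets of points with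
  \<open>\<kappa> x = K\<close> then span a space that contains every finite element function: it has a single value at each point, so on shared
  faces the polynomial of any adjacent simplex gives it.\<close>

lemma finite_span_fe_restriction:
  fixes \<Omega> :: "(real^'n) set"
  assumes "finite T" and cover: "\<Union>T = closure \<Omega>"
  obtains B where "finite B" "fe_restriction \<Omega> T p S \<subseteq> scale_fun.span B"
proof -
  define A where "A = {\<alpha> :: 'n \<Rightarrow> nat. (\<Sum>i\<in>UNIV. \<alpha> i) \<le> p}"
  have "finite A" unfolding A_def by (rule finite_multi_indices)
  have "\<forall>x. \<exists>K. x \<in> \<Union>T \<longrightarrow> K \<in> T \<and> x \<in> K" by blast
  then obtain \<kappa> where \<kappa>: "\<And>x. x \<in> \<Union>T \<Longrightarrow> \<kappa> x \<in> T \<and> x \<in> \<kappa> x" by metis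
  define b where "b = (\<lambda>(K, \<alpha>) (x :: real^'n). if x \<in> S \<inter> \<Union>T \<and> \<kappa> x = K
      then (\<Prod>i\<in>UNIV. of_real (x $ i) ^ \<alpha> i) else (0 :: complex))"
  show ?thesis
  proof (rule that)
    show "finite (b ` (T \<times> A))" using \<open>finite T\<close> \<open>finite A\<close> by simp
    show "fe_restriction \<Omega> T p S \<subseteq> scale_fun.span (b ` (T \<times> A))"
    proof
      fix v assume "v \<in> fe_restriction \<Omega> T p S"
      then obtain u where u: "u \<in> fe_space \<Omega> T p" "v = restrict_to S u"
        by (auto simp: fe_restriction_def)
      have "\<forall>K\<in>T. \<exists>c. \<forall>x\<in>K. u x = (\<Sum>\<alpha>\<in>A. c \<alpha> * (\<Prod>i\<in>UNIV. of_real (x $ i) ^ \<alpha> i))"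
        using u(1) unfolding fe_space_def polynomials_total_degree_def A_def by blast
      then obtain c where c: "\<And>K x. K \<in> T \<Longrightarrow> x \<in> K \<Longrightarrow>
          u x = (\<Sum>\<alpha>\<in>A. c K \<alpha> * (\<Prod>i\<in>UNIV. of_real (x $ i) ^ \<alpha> i))"
        by metis
      have "v = (\<Sum>K\<in>T. \<Sum>\<alpha>\<in>A. scale_fun (c K \<alpha>) (b (K, \<alpha>)))"
      proof
        fix x
        have "(\<Sum>K\<in>T. \<Sum>\<alpha>\<in>A. scale_fun (c K \<alpha>) (b (K, \<alpha>))) x
            = (\<Sum>K\<in>T. \<Sum>\<alpha>\<in>A. c K \<alpha> * b (K, \<alpha>) x)"
          by (simp add: sum_fun_apply scale_fun_def)
        also have "\<dots> = v x"
        proof (cases "x \<in> S \<inter> \<Union>T")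
          case True
          then have "\<kappa> x \<in> T" "x \<in> \<kappa> x" using \<kappa> by auto
          have "(\<Sum>K\<in>T. \<Sum>\<alpha>\<in>A. c K \<alpha> * b (K, \<alpha>) x)
              = (\<Sum>K\<in>T. if K = \<kappa> x then u x else 0)"
            using True c \<open>x \<in> \<kappa> x\<close> by (intro sum.cong refl) (auto simp: b_def)
          also have "\<dots> = u x" using \<open>finite T\<close> \<open>\<kappa> x \<in> T\<close> by simp
          finally show ?thesis using True u(2) by (simp add: restrict_to_def)
        next
          case False
          then have "v x = 0" using u cover by (auto simp: restrict_to_def fe_space_def)
          then show ?thesis using False by (auto simp: b_def)
        qed
        finally show "v x = (\<Sum>K\<in>T. \<Sum>\<alpha>\<in>A. scale_fun (c K \<alpha>) (b (K, \<alpha>))) x" by simp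
      qed
      also have "\<dots> \<in> scale_fun.span (b ` (T \<times> A))"
        by (intro scale_fun.span_sum scale_fun.span_scale scale_fun.span_base) auto
      finally show "v \<in> scale_fun.span (b ` (T \<times> A))" .
    qed
  qed
qed

section \<open>Surface measure on resolved Lipschitz boundaries\<close>

lemma sets_surface_measure [measurable_cong, simp]: "sets surface_measure = sets borel"
  by (simp add: surface_measure_def)

lemma space_surface_measure [simp]: "space surface_measure = UNIV"
  by (simp add: surface_measure_def)

lemma emeasure_surface_measure_facet:
  fixes K :: "(real^'n) set"
  assumes "int CARD('n) simplex K" "F facet_of K"
  shows "compact F" "emeasure surface_measure F < top"
proof -
  have "polytope K" using assms(1) by (rule simplex_imp_polytope)
  then have "polytope F" using assms(2) face_of_polytope_polytope facet_of_imp_face_of by blast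
  then show "compact F" by (rule polytope_imp_compact)
  have "aff_dim F < DIM(real^'n)"
    using assms aff_dim_simplex[OF assms(1)] by (simp add: facet_of_def)
  then obtain a b where ab: "a \<noteq> 0" "F \<subseteq> {x. a \<bullet> x = b}" by (rule aff_lowdim_subset_hyperplane)
  have "hausdorff_outer (CARD('n) - 1) F < top"
    using ab \<open>compact F\<close> by (intro hausdorff_outer_bounded_hyperplane[of F a b] compact_imp_bounded) auto
  then show "emeasure surface_measure F < top"
    unfolding surface_measure_def using \<open>compact F\<close>
    by (subst emeasure_hausdorff_measure) (auto intro: borel_closed compact_imp_closed)
qed

lemma emeasure_surface_measure_resolved:
  fixes \<Omega> :: "(real^'n) set"
  assumes mesh: "conforming_simplicial_mesh T \<Omega>" and "boundary_resolved_by T D"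
  shows "emeasure surface_measure (frontier D) < top"
proof -
  obtain \<F> where F: "\<F> \<subseteq> {F. \<exists>K\<in>T. F facet_of K}" "frontier D = \<Union>\<F>"
    using assms unfolding boundary_resolved_by_def by blast
  have simplex: "int CARD('n) simplex K" if "K \<in> T" for K
    using mesh that by (simp add: conforming_simplicial_mesh_def)
  have "finite T" using mesh by (simp add: conforming_simplicial_mesh_def triangulation_def)
  have "{F. \<exists>K\<in>T. F facet_of K} = (\<Union>K\<in>T. {F. F facet_of K})" by blast
  moreover have "finite {F. F facet_of K}" if "K \<in> T" for K
    using simplex[OF that] simplex_imp_polytope finite_polytope_facets by blast
  ultimately have "finite {F. \<exists>K\<in>T. F facet_of K}" using \<open>finite T\<close> by simp
  then have "finite \<F>" using F(1) finite_subset by blast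
  have facet: "compact F" "emeasure surface_measure F < top" if "F \<in> \<F>" for F
    using that F(1) emeasure_surface_measure_facet simplex by blast+
  have "emeasure surface_measure (\<Union>F\<in>\<F>. F) \<le> (\<Sum>F\<in>\<F>. emeasure surface_measure F)"
    using \<open>finite \<F>\<close> facet(1)
    by (intro emeasure_subadditive_finite) (auto intro: borel_closed compact_imp_closed)
  also have "\<dots> < top" using facet(2) \<open>finite \<F>\<close> by (simp add: ennreal_sum_less_top)
  finally show ?thesis using F(2) by simp
qed

lemma emeasure_surface_measure_frontier_ball_pos:
  fixes D :: "(real^'n) set"
  assumes "lipschitz_domain D" "x \<in> frontier D" "0 < r"
  shows "0 < emeasure surface_measure (frontier D \<inter> ball x r)"
  unfolding surface_measure_def
  using hausdorff_outer_lipschitz_frontier_pos[OF assms]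
  by (subst emeasure_hausdorff_measure) auto

lemma set_integrable_continuous_on_compact:
  fixes f :: "'a::metric_space \<Rightarrow> 'b::{banach, second_countable_topology}"
  assumes "compact S" "continuous_on S f" "emeasure M S < top" and M: "sets M = sets borel"
    and A: "A \<in> sets borel" "A \<subseteq> S"
  shows "set_integrable M A f"
proof -
  have S: "S \<in> sets borel" using \<open>compact S\<close> by (simp add: borel_closed compact_imp_closed)
  obtain B where B: "\<And>x. x \<in> S \<Longrightarrow> norm (f x) \<le> B"
    using compact_continuous_image[OF assms(2,1)] compact_imp_bounded bounded_iff by (metis imageI)
  have "(\<lambda>x. indicator S x *\<^sub>R f x) \<in> borel_measurable M"
    using borel_measurable_continuous_on_indicator[OF S assms(2)] M by (simp cong: measurable_cong_sets)
  then have "integrable M (\<lambda>x. indicator S x *\<^sub>R (indicator S x *\<^sub>R f x))"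
    using S M assms(3) B by (intro integrableI_bounded_set_indicator[where B = B]) (auto simp: less_top)
  moreover have "(\<lambda>x. indicator S x *\<^sub>R (indicator S x *\<^sub>R f x)) = (\<lambda>x. indicator S x *\<^sub>R f x)"
    by (auto simp: indicator_def)
  ultimately have "set_integrable M S f" unfolding set_integrable_def by metis
  then show ?thesis by (rule set_integrable_subset) (use A M in auto)
qed

text \<open>If \<open>f\<close> were positive at \<open>x\<close>, it would be positive on a relatively open piece of the boundary, and this has positive
  measure.\<close>

lemma zero_on_frontier_part_if_integral_zero:
  fixes D :: "(real^'n) set" and f :: "real^'n \<Rightarrow> real"
  assumes D: "lipschitz_domain D" and fin: "emeasure surface_measure (frontier D) < top"
    and "closed C" and cont: "continuous_on (frontier D - C) f"
    and nonneg: "\<And>x. x \<in> frontier D - C \<Longrightarrow> 0 \<le> f x"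
    and int: "set_integrable surface_measure (frontier D - C) f"
    and zero: "(LINT x:frontier D - C|surface_measure. f x) = 0"
    and x: "x \<in> frontier D - C"
  shows "f x = 0"
proof (rule ccontr)
  assume "f x \<noteq> 0"
  then have "f x > 0" using nonneg[OF x] by simp
  obtain d where d: "d > 0" "\<And>y. y \<in> frontier D - C \<Longrightarrow> dist y x < d \<Longrightarrow> dist (f y) (f x) < f x"
    using cont x \<open>f x > 0\<close> unfolding continuous_on_iff by metis
  obtain e where e: "e > 0" "ball x e \<subseteq> - C"
    using \<open>closed C\<close> x open_contains_ball[of "- C"] by (auto simp: open_Compl)
  define r where "r = min d e"
  have pos: "f y > 0" if "y \<in> frontier D \<inter> ball x r" for y
  proof -
    have "y \<in> frontier D - C" "dist y x < d" using that e by (auto simp: r_def dist_commute)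
    then have "dist (f y) (f x) < f x" by (rule d(2))
    then show ?thesis by (auto simp: dist_real_def)
  qed
  have "AE y in surface_measure. indicator (frontier D - C) y *\<^sub>R f y = 0"
    using zero int nonneg unfolding set_lebesgue_integral_def set_integrable_def
    by (subst integral_nonneg_eq_0_iff_AE[symmetric]) (auto simp: indicator_def)
  then have "AE y in surface_measure. y \<notin> frontier D \<inter> ball x r"
  proof (rule AE_mp, intro AE_I2 impI notI)
    fix y assume y: "y \<in> frontier D \<inter> ball x r" and 0: "indicator (frontier D - C) y *\<^sub>R f y = 0"
    have "y \<in> frontier D - C" using y e by (auto simp: r_def)
    then show False using pos[OF y] 0 by simp
  qed
  then have "emeasure surface_measure (frontier D \<inter> ball x r) = 0"
    by (subst (asm) AE_iff_measurable[of "frontier D \<inter> ball x r"]) auto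
  then show False
    using emeasure_surface_measure_frontier_ball_pos[OF D, of x r] x d(1) e(1) by (simp add: r_def)
qed

section \<open>Discrete impedance data on one subdomain\<close>

text \<open>Only the impedance term breaks Hermitian symmetry. The identity holds for arbitrary functions, because
  conjugation commutes with the integral even where the latter has the default value 0.\<close>

lemma helmholtz_form_cnj:
  fixes D :: "(real^'n) set"
  shows
  "helmholtz_form k D u v = cnj (helmholtz_form k D v u)
     - 2 * \<i> * of_real k * (LINT x:frontier D|surface_measure. u x * cnj (v x))"
proof -
  have cnj_integral: "(LINT x:A|M. f x) = cnj (LINT x:A|M. g x)"
    if "\<And>x. f x = cnj (g x)" for A M and f g :: "real^'n \<Rightarrow> complex"
    using that by (simp add: set_lebesgue_integral_def flip: Bochner_Integration.integral_cnj)
  define vol :: "(real^'n \<Rightarrow> complex) \<Rightarrow> (real^'n \<Rightarrow> complex) \<Rightarrow> complex"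
    where "vol u v = (LINT x:D|lebesgue. (\<Sum>i\<in>UNIV. grad u x $ i * cnj (grad v x $ i))
      - (of_real k)\<^sup>2 * u x * cnj (v x))" for u v
  define bd :: "(real^'n \<Rightarrow> complex) \<Rightarrow> (real^'n \<Rightarrow> complex) \<Rightarrow> complex"
    where "bd u v = (LINT x:frontier D|surface_measure. u x * cnj (v x))" for u v
  have "vol u v = cnj (vol v u)"
    unfolding vol_def by (rule cnj_integral) (simp add: cnj_sum mult_ac)
  moreover have "bd u v = cnj (bd v u)"
    unfolding bd_def by (rule cnj_integral) (simp add: mult_ac)
  ultimately show ?thesis
    unfolding helmholtz_form_def vol_def[symmetric] bd_def[symmetric] by (simp add: algebra_simps)
qed

text \<open>A single subdomain \<open>D\<close> of the covering; \<open>V\<close> below is the local finite element space, \<open>W\<close> the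
  space of traces on the interface \<open>\<Gamma>\<close>, and \<open>a\<close> the Helmholtz form.\<close>

locale helmholtz_subdomain =
  fixes \<Omega> D :: "(real^'n) set" and T :: "(real^'n) set set" and k :: real and p :: nat
  assumes bounded_domain: "bounded \<Omega>"
    and mesh: "conforming_simplicial_mesh T \<Omega>"
    and lipschitz: "lipschitz_domain D"
    and resolved: "boundary_resolved_by T D"
    and subdomain: "D \<subseteq> \<Omega>"
    and invertible: "bij_betw (helmholtz_operator k D (fe_restriction \<Omega> T p (closure D)))
      (fe_restriction \<Omega> T p (closure D)) (antidual (fe_restriction \<Omega> T p (closure D)))"
begin

abbreviation V where "V \<equiv> fe_restriction \<Omega> T p (closure D)"
abbreviation \<Gamma> where "\<Gamma> \<equiv> interface \<Omega> D"
abbreviation W where "W \<equiv> fe_restriction \<Omega> T p \<Gamma>"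
abbreviation V\<^sub>0 where "V\<^sub>0 \<equiv> discrete_helmholtz_space k \<Omega> T p D"
abbreviation a where "a \<equiv> helmholtz_form k D"
abbreviation imp where "imp \<equiv> discrete_impedance k \<Omega> T p D"

definition interface_form :: "(real^'n \<Rightarrow> complex) \<Rightarrow> (real^'n \<Rightarrow> complex) \<Rightarrow> complex" where
  "interface_form g h = (LINT x:\<Gamma>|surface_measure. g x * cnj (h x))"

lemmas V_zero = scale_fun.subspace_0[OF subspace_fe_restriction[of \<Omega> T p "closure D"]]
lemmas V_add = scale_fun.subspace_add[OF subspace_fe_restriction[of \<Omega> T p "closure D"]]
lemmas V_scale = scale_fun.subspace_scale[OF subspace_fe_restriction[of \<Omega> T p "closure D"]]
lemmas V_diff = scale_fun.subspace_diff[OF subspace_fe_restriction[of \<Omega> T p "closure D"]]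
lemmas W_add = scale_fun.subspace_add[OF subspace_fe_restriction[of \<Omega> T p "interface \<Omega> D"]]
lemmas W_scale = scale_fun.subspace_scale[OF subspace_fe_restriction[of \<Omega> T p "interface \<Omega> D"]]

lemma closure_subset: "closure D \<subseteq> closure \<Omega>"
  using subdomain by (rule closure_mono)

lemma interface_subset: "\<Gamma> \<subseteq> frontier D" "\<Gamma> \<subseteq> closure D"
  by (auto simp: interface_def frontier_def)

lemma frontier_subset: "frontier D \<subseteq> closure D"
  by (auto simp: frontier_def)

lemma bounded_subdomain: "bounded D"
  using bounded_domain subdomain by (rule bounded_subset)

lemma finite_frontier: "emeasure surface_measure (frontier D) < top"
  using mesh resolved by (rule emeasure_surface_measure_resolved)

lemma sets_interface: "\<Gamma> \<in> sets borel"
  unfolding interface_def by auto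

lemma interface_integrable:
  fixes f :: "real^'n \<Rightarrow> 'b::{banach, second_countable_topology}"
  assumes "continuous_on (frontier D) f"
  shows "set_integrable surface_measure \<Gamma> f"
  using bounded_subdomain finite_frontier assms sets_interface interface_subset(1)
  by (intro set_integrable_continuous_on_compact[where S = "frontier D"]) (auto simp: compact_frontier_bounded)

lemma frontier_integrable:
  fixes f :: "real^'n \<Rightarrow> complex"
  assumes "continuous_on (frontier D) f"
  shows "set_integrable surface_measure (frontier D) f"
  using bounded_subdomain finite_frontier assms
  by (intro set_integrable_continuous_on_compact[where S = "frontier D"]) (auto simp: compact_frontier_bounded)

lemma trace_lift:
  assumes "h \<in> W"
  obtains v where "v \<in> V" "restrict_to \<Gamma> v = h"
proof -
  obtain u where u: "u \<in> fe_space \<Omega> T p" "h = restrict_to \<Gamma> u" using assms by (auto simp: fe_restriction_def)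
  show ?thesis
  proof
    show "restrict_to (closure D) u \<in> V" using u(1) by (simp add: fe_restriction_def)
    show "restrict_to \<Gamma> (restrict_to (closure D) u) = h"
      using u(2) interface_subset(2) by (simp add: restrict_to_restrict_to)
  qed
qed

lemma trace_in: "v \<in> V \<Longrightarrow> restrict_to \<Gamma> v \<in> W"
  using interface_subset(2) by (auto simp: fe_restriction_def restrict_to_restrict_to)

lemma interface_form_trace:
  "interface_form (restrict_to \<Gamma> u) h = interface_form u h"
  "interface_form u (restrict_to \<Gamma> h) = interface_form u h"
  unfolding interface_form_def using sets_interface
  by (auto intro!: set_lebesgue_integral_cong simp: restrict_to_def)

lemma interface_form_integrable:
  assumes "u \<in> V" "v \<in> V"
  shows "set_integrable surface_measure \<Gamma> (\<lambda>x. u x * cnj (v x))"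
  using assms frontier_subset closure_subset
  by (intro interface_integrable continuous_intros) (auto intro: continuous_on_fe_restriction)

lemma interface_form_add: "\<lbrakk>u \<in> V; v \<in> V; w \<in> V\<rbrakk> \<Longrightarrow> interface_form (u + v) w = interface_form u w + interface_form v w"
  unfolding interface_form_def
  by (simp add: ring_distribs interface_form_integrable)

lemma interface_form_self: "interface_form u u = of_real (LINT x:\<Gamma>|surface_measure. (cmod (u x))\<^sup>2)"
  unfolding interface_form_def set_integral_complex_of_real[symmetric]
  by (simp flip: complex_norm_square)

text \<open>The square is integrated for an extension \<open>v\<close> of \<open>u\<close> to the closed subdomain, since \<open>v\<close> is continuous on the compact
  boundary.\<close>

lemma interface_form_definite:
  assumes "u \<in> W" "u \<noteq> 0"
  shows "0 < Re (interface_form u u)"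
proof -
  obtain v where v: "v \<in> V" "restrict_to \<Gamma> v = u" using trace_lift[OF assms(1)] .
  let ?q = "\<lambda>x. (cmod (v x))\<^sup>2"
  have cont: "continuous_on (frontier D) v"
    using v(1) frontier_subset closure_subset by (intro continuous_on_fe_restriction[OF v(1)]) auto
  have "interface_form u u = interface_form v v"
    using interface_form_trace[of v] interface_form_trace(2)[of u v] v(2) by simp
  then have eq: "Re (interface_form u u) = (LINT x:\<Gamma>|surface_measure. ?q x)"
    by (simp add: interface_form_self)
  have "0 \<le> (LINT x:\<Gamma>|surface_measure. ?q x)"
    unfolding set_lebesgue_integral_def by (intro Bochner_Integration.integral_nonneg) (auto simp: indicator_def)
  moreover have "(LINT x:\<Gamma>|surface_measure. ?q x) \<noteq> 0"
  proof
    assume zero: "(LINT x:\<Gamma>|surface_measure. ?q x) = 0"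
    have int: "set_integrable surface_measure \<Gamma> ?q"
      using cont by (intro interface_integrable continuous_intros)
    have "continuous_on (frontier D - frontier \<Omega>) ?q"
      using cont by (intro continuous_intros) (auto intro: continuous_on_subset)
    then have "?q x = 0" if "x \<in> \<Gamma>" for x
      using that zero int unfolding interface_def
      by (intro zero_on_frontier_part_if_integral_zero[OF lipschitz finite_frontier, of "frontier \<Omega>" ?q]) auto
    then have "u = 0" unfolding v(2)[symmetric] by (simp add: restrict_to_zero_iff)
    then show False using assms(2) by simp
  qed
  ultimately show ?thesis using eq by simp
qed

sublocale interface_form: definite_hermitian_form scale_fun W interface_form
proof (unfold_locales)
  show "scale_fun.subspace W" by (rule subspace_fe_restriction)
next
  fix u v w assume "u \<in> W" "v \<in> W" "w \<in> W"
  then obtain u' v' w' where *: "u' \<in> V" "restrict_to \<Gamma> u' = u" "v' \<in> V" "restrict_to \<Gamma> v' = v"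
    "w' \<in> V" "restrict_to \<Gamma> w' = w" by (metis trace_lift)
  have "interface_form (u + v) w = interface_form (u' + v') w'"
    unfolding *(2,4,6)[symmetric] restrict_to_add[symmetric] interface_form_trace ..
  then show "interface_form (u + v) w = interface_form u w + interface_form v w"
    using interface_form_add * interface_form_trace by metis
next
  fix u w :: "real^'n \<Rightarrow> complex" and c
  show "interface_form (scale_fun c u) w = c * interface_form u w"
    unfolding interface_form_def scale_fun_def by (simp add: mult.assoc)
  show "interface_form u w = cnj (interface_form w u)"
    unfolding interface_form_def set_lebesgue_integral_def
    by (simp add: mult.commute flip: Bochner_Integration.integral_cnj)
next
  show "\<And>u. u \<in> W \<Longrightarrow> u \<noteq> 0 \<Longrightarrow> 0 < Re (interface_form u u)" by (rule interface_form_definite)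
qed

text \<open>Contained in the invertibility assumption, by which the operator maps into the antidual space.\<close>

lemma form_antilinear_right:
  assumes "w \<in> V"
  shows "u \<in> V \<Longrightarrow> v \<in> V \<Longrightarrow> a w (u + v) = a w u + a w v"
    and "u \<in> V \<Longrightarrow> a w (scale_fun c u) = cnj c * a w u"
proof -
  have anti: "helmholtz_operator k D V w \<in> antidual V"
    using invertible assms by (auto simp: bij_betw_def)
  show "a w (u + v) = a w u + a w v" if "u \<in> V" "v \<in> V"
    using anti that V_add
    by (auto simp: antidual_def helmholtz_operator_def)
  show "a w (scale_fun c u) = cnj c * a w u" if "u \<in> V"
    using anti that V_scale
    by (auto simp: antidual_def helmholtz_operator_def)
qed

text \<open>Transfer antilinearity from the second argument; the correction is a boundary integral of continuous functions.\<close>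

lemma form_linear_left:
  assumes "w \<in> V"
  shows "u \<in> V \<Longrightarrow> v \<in> V \<Longrightarrow> a (u + v) w = a u w + a v w"
    and "u \<in> V \<Longrightarrow> a (scale_fun c u) w = c * a u w"
proof -
  have cont: "continuous_on (frontier D) u" if "u \<in> V" for u
    using frontier_subset closure_subset by (intro continuous_on_fe_restriction[OF that]) auto
  have int: "set_integrable surface_measure (frontier D) (\<lambda>x. u x * cnj (w x))" if "u \<in> V" for u
    using cont[OF that] cont[OF assms] by (intro frontier_integrable continuous_intros)
  note form_eq = helmholtz_form_cnj[of k D _ w]
  show "a (u + v) w = a u w + a v w" if "u \<in> V" "v \<in> V"
    unfolding form_eq[of "u + v"] form_eq[of u] form_eq[of v]
    using form_antilinear_right(1)[OF assms that] int that by (simp add: ring_distribs)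
  show "a (scale_fun c u) w = c * a u w" if "u \<in> V"
    unfolding form_eq[of "scale_fun c u"] form_eq[of u]
    using form_antilinear_right(2)[OF assms that] by (simp add: scale_fun_def mult.assoc algebra_simps)
qed

lemma form_nondegenerate:
  assumes "w \<in> V" and zero: "\<And>v. v \<in> V \<Longrightarrow> a w v = 0"
  shows "w = 0"
proof -
  have "0 \<in> V" by (rule V_zero)
  have "a 0 v = 0" if "v \<in> V" for v
    using form_linear_left(2)[OF that \<open>0 \<in> V\<close>, of 0] by simp
  then have "helmholtz_operator k D V w = helmholtz_operator k D V 0"
    using zero by (auto simp: helmholtz_operator_def restrict_def)
  then show ?thesis
    using invertible assms(1) \<open>0 \<in> V\<close> by (auto simp: bij_betw_def inj_on_def)
qed

lemma subspace_V0: "scale_fun.subspace V\<^sub>0"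
proof -
  have "a 0 v = 0" if "v \<in> V" for v
    using form_linear_left(2)[OF that V_zero, of 0] by simp
  then show ?thesis
    unfolding discrete_helmholtz_space_def
    using form_linear_left V_zero V_add V_scale
    by (intro scale_fun.subspaceI) auto
qed

lemma V0_subset: "w \<in> V\<^sub>0 \<Longrightarrow> w \<in> V"
  by (simp add: discrete_helmholtz_space_def)

text \<open>Two test functions with the same trace differ by one that vanishes on the interface, and elements of \<open>V\<^sub>0\<close> are
  orthogonal to those. Hence \<open>a w\<close> descends to a functional on traces.\<close>

lemma V0_annihilates:
  assumes w: "w \<in> V\<^sub>0" and "v \<in> V" "v' \<in> V" "restrict_to \<Gamma> v = restrict_to \<Gamma> v'"
  shows "a w v = a w v'"
proof -
  have d: "v - v' \<in> V" using assms V_diff by blast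
  have "(v - v') x = 0" if "x \<in> \<Gamma>" for x
    using that fun_cong[OF assms(4), of x] by (simp add: restrict_to_def)
  then have "a w (v - v') = 0" using w d by (simp add: discrete_helmholtz_space_def)
  then show ?thesis
    using form_antilinear_right(1)[OF V0_subset[OF w] d \<open>v' \<in> V\<close>] by simp
qed

text \<open>The functional that \<open>a w\<close> induces on traces has a Riesz representative with respect to the \<open>L\<^sup>2\<close> product on the interface.\<close>

lemma impedance_ex1:
  assumes w: "w \<in> V\<^sub>0"
  shows "\<exists>!g. g \<in> W \<and> (\<forall>v\<in>V. interface_form g v = a w v)"
proof (rule ex_ex1I)
  have wV: "w \<in> V" by (rule V0_subset[OF w])
  define lift where "lift h = (SOME v. v \<in> V \<and> restrict_to \<Gamma> v = h)" for h
  have lift: "lift h \<in> V" "restrict_to \<Gamma> (lift h) = h" if "h \<in> W" for h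
    unfolding lift_def using someI_ex[of "\<lambda>v. v \<in> V \<and> restrict_to \<Gamma> v = h"] trace_lift[OF that] by blast+
  define F where "F h = a w (lift h)" for h
  have F: "F (restrict_to \<Gamma> v) = a w v" if "v \<in> V" for v
    unfolding F_def using lift[OF trace_in[OF that]] that by (intro V0_annihilates[OF w])
  have finT: "finite T" "\<Union>T = closure \<Omega>"
    using mesh by (auto simp: conforming_simplicial_mesh_def triangulation_def)
  obtain B where B: "finite B" "W \<subseteq> scale_fun.span B"
    using finite_span_fe_restriction[OF finT] .
  have "\<exists>g\<in>W. \<forall>h\<in>W. interface_form g h = F h"
  proof (rule interface_form.riesz_representation[OF B])
    fix u v assume "u \<in> W" "v \<in> W"
    then show "F (u + v) = F u + F v"
      using F[of "lift u + lift v"] lift V_add form_antilinear_right(1)[OF wV]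
      by (simp add: restrict_to_add F_def)
  next
    fix c u assume "u \<in> W"
    then show "F (scale_fun c u) = cnj c * F u"
      using F[of "scale_fun c (lift u)"] lift V_scale form_antilinear_right(2)[OF wV]
      by (simp add: restrict_to_scale F_def)
  qed
  then obtain g where g: "g \<in> W" "\<And>h. h \<in> W \<Longrightarrow> interface_form g h = F h" by blast
  have "interface_form g v = a w v" if "v \<in> V" for v
    using g(2)[OF trace_in[OF that]] F[OF that] interface_form_trace(2)[of g v] by simp
  then show "\<exists>g. g \<in> W \<and> (\<forall>v\<in>V. interface_form g v = a w v)" using g(1) by blast
next
  fix g g' assume g: "g \<in> W \<and> (\<forall>v\<in>V. interface_form g v = a w v)"
    and g': "g' \<in> W \<and> (\<forall>v\<in>V. interface_form g' v = a w v)"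
  show "g = g'"
  proof (rule interface_form.eq_if_form_eq)
    fix h assume "h \<in> W"
    then obtain v where "v \<in> V" "restrict_to \<Gamma> v = h" by (rule trace_lift)
    then show "interface_form g h = interface_form g' h"
      using g g' interface_form_trace(2) by metis
  qed (use g g' in auto)
qed

lemma impedance:
  assumes "w \<in> V\<^sub>0"
  shows "imp w \<in> W" and "v \<in> V \<Longrightarrow> interface_form (imp w) v = a w v"
proof -
  have "imp w = (THE g. g \<in> W \<and> (\<forall>v\<in>V. interface_form g v = a w v))"
    by (simp add: discrete_impedance_def interface_form_def)
  then have "imp w \<in> W \<and> (\<forall>v\<in>V. interface_form (imp w) v = a w v)"
    using theI'[OF impedance_ex1[OF assms]] by simp
  then show "imp w \<in> W" and "v \<in> V \<Longrightarrow> interface_form (imp w) v = a w v" by auto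
qed

lemma impedance_eqI:
  assumes "w \<in> V\<^sub>0" "g \<in> W" "\<And>v. v \<in> V \<Longrightarrow> interface_form g v = a w v"
  shows "imp w = g"
  using impedance_ex1[OF assms(1)] impedance[OF assms(1)] assms(2,3) by metis

text \<open>The identity defining \<open>imp\<close> tests with functions on the subdomain rather than with traces, so linearity of
  \<open>interface_form\<close> is needed for these too.\<close>

lemma interface_form_extend:
  assumes "v \<in> V" shows "u \<in> W \<Longrightarrow> u' \<in> W \<Longrightarrow> interface_form (u + u') v = interface_form u v + interface_form u' v"
    and "u \<in> W \<Longrightarrow> interface_form (scale_fun c u) v = c * interface_form u v"
  using interface_form.add_left[of u u' "restrict_to \<Gamma> v"] interface_form.scale_left[of u "restrict_to \<Gamma> v" c]
    trace_in[OF assms] interface_form_trace(2) by auto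

lemma norm_on_local_norm: "norm_on scale_fun V\<^sub>0 (local_norm k \<Omega> T p D)"
proof -
  have "norm_on scale_fun V\<^sub>0 (\<lambda>w. sqrt (Re (interface_form (imp w) (imp w))))"
  proof (rule norm_on_pullback[OF interface_form.norm_on_form_norm])
    show "vector_space scale_fun" by (rule vector_space_scale_fun)
    show "scale_fun.subspace V\<^sub>0" by (rule subspace_V0)
    show "imp u \<in> W" if "u \<in> V\<^sub>0" for u using impedance(1)[OF that] .
    show "imp (u + v) = imp u + imp v" if uv: "u \<in> V\<^sub>0" "v \<in> V\<^sub>0" for u v
      using uv impedance V0_subset interface_form_extend(1) form_linear_left(1)
        scale_fun.subspace_add[OF subspace_V0] W_add
      by (intro impedance_eqI) auto
    show "imp (scale_fun c u) = scale_fun c (imp u)" if u: "u \<in> V\<^sub>0" for c u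
      using u impedance V0_subset interface_form_extend(2) form_linear_left(2)
        scale_fun.subspace_scale[OF subspace_V0] W_scale
      by (intro impedance_eqI) auto
    show "imp u = 0 \<longleftrightarrow> u = 0" if u: "u \<in> V\<^sub>0" for u
    proof
      assume 0: "imp u = 0"
      have "a u v = 0" if "v \<in> V" for v
        using impedance(2)[OF u that] 0 interface_form.zero_left[OF trace_in[OF that]] interface_form_trace(2)
        by simp
      then show "u = 0" using V0_subset[OF u] by (intro form_nondegenerate)
    next
      assume "u = 0"
      then have "a u v = 0" if "v \<in> V" for v
        using form_linear_left(2)[OF that V0_subset[OF u], of 0] by simp
      then show "imp u = 0"
        using interface_form.zero_left[OF trace_in] interface_form_trace(2)
        by (intro impedance_eqI[OF u]) (auto simp: scale_fun.subspace_0[OF subspace_fe_restriction])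
    qed
  qed
  then show ?thesis by (simp add: interface_form_self local_norm_def[abs_def])
qed

end

section \<open>The local norms and the norm on the product space\<close>

theorem proposition3p6:
  fixes \<Omega> :: "(real^'n) set" and T :: "(real^'n) set set" and \<Omega>s :: "nat \<Rightarrow> (real^'n) set"
    and k :: real and p N :: nat
  assumes dim: "CARD('n) = 2 \<or> CARD('n) = 3"
    and domain: "lipschitz_domain \<Omega>" "bounded \<Omega>"
    and wavenumber: "k > 0"
    and mesh: "conforming_simplicial_mesh T \<Omega>"
    and subdomains: "\<And>l. l \<in> {1..N} \<Longrightarrow> lipschitz_domain (\<Omega>s l)"
    and resolved: "\<And>l. l \<in> {1..N} \<Longrightarrow> boundary_resolved_by T (\<Omega>s l)"
    and cover: "(\<Union>l\<in>{1..N}. \<Omega>s l) = \<Omega>"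
    and invertible: "\<And>l. l \<in> {1..N} \<Longrightarrow>
      bij_betw (helmholtz_operator k (\<Omega>s l) (fe_restriction \<Omega> T p (closure (\<Omega>s l))))
        (fe_restriction \<Omega> T p (closure (\<Omega>s l)))
        (antidual (fe_restriction \<Omega> T p (closure (\<Omega>s l))))"
  shows "(\<forall>l\<in>{1..N}. norm_on scale_fun (discrete_helmholtz_space k \<Omega> T p (\<Omega>s l))
                        (local_norm k \<Omega> T p (\<Omega>s l)))
       \<and> norm_on scale_tuple (product_space k \<Omega> T p N \<Omega>s) (product_norm k \<Omega> T p N \<Omega>s)"
proof
  have local: "norm_on scale_fun (discrete_helmholtz_space k \<Omega> T p (\<Omega>s l)) (local_norm k \<Omega> T p (\<Omega>s l))"
    if l: "l \<in> {1..N}" for l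
  proof -
    interpret helmholtz_subdomain \<Omega> "\<Omega>s l" T k p
      using domain(2) mesh subdomains[OF l] resolved[OF l] cover l invertible[OF l]
      by unfold_locales auto
    show ?thesis by (rule norm_on_local_norm)
  qed
  then show "\<forall>l\<in>{1..N}. norm_on scale_fun (discrete_helmholtz_space k \<Omega> T p (\<Omega>s l)) (local_norm k \<Omega> T p (\<Omega>s l))"
    by blast
  show "norm_on scale_tuple (product_space k \<Omega> T p N \<Omega>s) (product_norm k \<Omega> T p N \<Omega>s)"
    unfolding product_space_def product_norm_def[abs_def] using local by (intro norm_on_l2_product) auto
qed

end
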